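(* Let $A$ be an SA-hypergraph automaton without any strong loops. Then the picture language $p(\mathcal{L}(A))$ associated to the graph language accepted by $A$ is WTS-recognizable, i.e. there is a Wang tile system $W$ with $\mathcal{L}(W)=p(\mathcal{L}(A))$.
   Context: Pictures: a picture over a finite alphabet $\Sigma$ is an $h\times w$ matrix of letters of $\Sigma$; $\Sigma^{**}$ is the set of all pictures. Two positions $(i,j),(i',j')$ are adjacent if $|i-i'|+|j-j'|=1$. Wang tile systems: a labelled Wang tile is $(c_N,c_E,c_S,c_W,l)$ with label $l\in\Sigma$ and edge colours $c_N,c_E,c_S,c_W\in C\cup\{\#\}$ (north, east, south, west), $C$ a finite set of colours, $\#\notin C$ meaning "uncoloured"; tiles cannot be rotated. A Wang tile system is $W=(\Sigma,C,\Theta)$ with $\Theta$ a finite set of such tiles. A picture $p$ of height $h$, width $w$ is in $\mathcal{L}(W)$ iff there is $m:[h]\times[w]\to\Theta$ such that the label of $m(i,j)$ is $p_{(i,j)}$; for $(i,j),(i+1,j)$ the south colour of $m(i,j)$ and north colour of $m(i+1,j)$ are the same colour from $C$; for $(i,j),(i,j+1)$ the east colour of $m(i,j)$ and west colour of $m(i,j+1)$ are the same colour from $C$; and for positions with $i=1$, $j=1$, $i=h$, $j=w$ the north, west, south, east colour respectively of $m(i,j)$ is $\#$. A picture language is WTS-recognizable if it equals $\mathcal{L}(W)$ for some Wang tile system $W$. Graphs: a pseudo-picture graph is $G=(N,E_v\cup E_h,\pi)$ with finite $N$, disjoint $E_v,E_h\subseteq N\times N$ (vertical and horizontal edges) and $\pi:N\to\Sigma$.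 The subgraph induced by $N'\subseteq N$ keeps nodes $N'$, the edges of $E_v,E_h$ between them and the restricted labelling (a full subgraph). $G$ is an $n\times m$ picture graph if there is a bijection $f_G:N\to[n]\times[m]$ with $(x,y)\in E_v$ iff $f_G(x)+(1,0)=f_G(y)$ and $(x,y)\in E_h$ iff $f_G(x)+(0,1)=f_G(y)$ (row increases downwards, column rightwards); it represents the picture $p(G)$ with $p(G)_{(i,j)}=\pi(f_G^{-1}(i,j))$. $\mathcal{G}$ is the set of picture graphs. A subgrid is a connected pseudo-picture graph which is a full subgraph of some picture graph. SA-hypergraph automata: a hypergraph is $H=(N,E,f)$ with finite $N$, finite hyperedge set $E$, $f:E\to\mathcal{P}(N)$; $I_H(e)=\{x\in N:\exists e'\in E\setminus\{e\},\ x\in f(e)\cap f(e')\}$. An SA-hypergraph automaton is $A=(N,E,f,d,G,E_0)$ with $(N,E,f)$ a hypergraph, $d(e)=Q_1\to Q_2$ with $Q_1,Q_2\subseteq I_H(e)$ for each $e\in E$ (incoming/outgoing active nodes), $G=(N,E_v\cup E_h,\pi)$ a pseudo-picture graph (underlying graph) and $E_0\subseteq E$ (initial hyperedges). $G_e$ denotes the subgraph of $G$ induced by $f(e)$; $G_e$ and the subgraph of $G_e$ induced by $Q_1$ are required to be connected. A configuration is $(M,O,g)$ with $M=(N_M,E_{M,v}\cup E_{M,h},\pi_M)$ a subgrid, $O\subseteq N_M$ (active nodes), $g:N_M\to N$ with $\pi_M=\pi\circ g$. For a configuration $(M_1,O_1,g_1)$ ($M_1$ with nodes $N_1$, edges $E_{1,v},E_{1,h}$)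 and $e\in E$ with $d(e)=Q_1\to Q_2$: if some nonempty $P\subseteq O_1$ is such that $g_1|_P$ is a graph isomorphism from the subgraph of $M_1$ induced by $P$ onto the subgraph of $G_e$ induced by $Q_1$, there is a transition $(M_1,O_1,g_1)\to_A(M_2,O_2,g_2)$: with fresh copies $N'=\{x':x\in f(e)\setminus Q_1\}$, $N_2=N_1\cup N'$, $g_2=g_1$ on $N_1$, $g_2(x')=x$; $(x,y)\in E_{2,v}$ iff $(x,y)\in E_{1,v}$ or ($x,y\in P\cup N'$ and $(g_2(x),g_2(y))\in E_v$), analogously for $E_{2,h}$; $\pi_2=\pi\circ g_2$; $O_2=(O_1\setminus P)\cup\{x'\in N':x\in Q_2\}$ (with $(M_2,O_2,g_2)$ being a configuration). $\overset{*}{\to}_A$ is the reflexive transitive closure. For $e\in E_0$ with $d(e)=Q_1\to O_e$, $(G_e,O_e,\mathrm{id})$ is an initial configuration. $\mathcal{L}(A)=\{M\in\mathcal{G}:\exists e\in E_0,\ (G_e,O_e,\mathrm{id})\overset{*}{\to}_A(M,\emptyset,g)\text{ for some }g\}$ and $p(\mathcal{L}(A))=\{p(M):M\in\mathcal{L}(A)\}$. Strong loops: a sequence of hyperedges $\langle e_0,e_1,\ldots,e_n\rangle$ of $A$ is a (derivation) loop if $e_0=e_n$ and $Q_{2,i}\cap Q_{1,i+1}\neq\emptyset$ for $0\le i<n$, where $d(e_i)=Q_{1,i}\to Q_{2,i}$. Let $G_i=G_{e_i}$ and $O_i=Q_{2,i}\cap Q_{1,i+1}$. For a node $x$ of $G_0=G_n$,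 consider a walk in the underlying graph $G$ from $x$ back to $x$ which visits only the subgraphs $G_0,\ldots,G_n$ in this order and passes through at least one node of each $O_i$, where edges may be traversed in either direction. The loop is a strong loop if, along such a walk, the number of horizontal edges traversed against their direction (incoming) equals the number traversed along their direction (outgoing), and likewise for vertical edges (i.e. the walk has zero net displacement when horizontal edges are read as one step right and vertical edges as one step down). *)

theory Defs
  imports "Jordan_Normal_Form.Matrix"
begin

section \<open>Pictures and Wang tile systems\<close>

text \<open>
  Pictures are matrices with at least one row and one column.  Positions are counted from 0,
  row first, with rows increasing downwards.
\<close>

definition pictures :: "'s set \<Rightarrow> 's mat set" where
  "pictures \<Sigma> = {p. 0 < dim_row p \<and> 0 < dim_col p \<and> elements_mat p \<subseteq> \<Sigma>}"

text \<open>The colour \<open>None\<close> is the symbol \<open>#\<close> (uncoloured); \<open>Some c\<close> is the colour \<open>c\<close>.\<close>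

record ('s, 'c) wang_tile =
  north :: "'c option"
  east :: "'c option"
  south :: "'c option"
  west :: "'c option"
  tile_label :: 's

record ('s, 'c) wang_tile_system =
  wts_alphabet :: "'s set"
  colours :: "'c set"
  tiles :: "('s, 'c) wang_tile set"

definition wang_tile_system :: "('s, 'c) wang_tile_system \<Rightarrow> bool" where
  "wang_tile_system W \<longleftrightarrow>
     finite (wts_alphabet W) \<and> finite (colours W) \<and> finite (tiles W) \<and>
     (\<forall>t \<in> tiles W. tile_label t \<in> wts_alphabet W \<and>
        {north t, east t, south t, west t} \<subseteq> insert None (Some ` colours W))"

definition wts_tiling :: "('s, 'c) wang_tile_system \<Rightarrow> 's mat
    \<Rightarrow> (nat \<times> nat \<Rightarrow> ('s, 'c) wang_tile) \<Rightarrow> bool" where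
  "wts_tiling W p m \<longleftrightarrow> (let h = dim_row p; w = dim_col p in
     (\<forall>i<h. \<forall>j<w. m (i, j) \<in> tiles W \<and> tile_label (m (i, j)) = p $$ (i, j)) \<and>
     (\<forall>i j. Suc i < h \<and> j < w \<longrightarrow>
        (\<exists>c \<in> colours W. south (m (i, j)) = Some c \<and> north (m (Suc i, j)) = Some c)) \<and>
     (\<forall>i j. i < h \<and> Suc j < w \<longrightarrow>
        (\<exists>c \<in> colours W. east (m (i, j)) = Some c \<and> west (m (i, Suc j)) = Some c)) \<and>
     (\<forall>j<w. north (m (0, j)) = None \<and> south (m (h - 1, j)) = None) \<and>
     (\<forall>i<h. west (m (i, 0)) = None \<and> east (m (i, w - 1)) = None))"

definition wts_language :: "('s, 'c) wang_tile_system \<Rightarrow> 's mat set" where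
  "wts_language W = {p \<in> pictures (wts_alphabet W). \<exists>m. wts_tiling W p m}"

text \<open>
  Colour sets are finite, so taking colours from \<^typ>\<open>nat\<close> is no restriction.
\<close>

definition wts_recognizable :: "'s set \<Rightarrow> 's mat set \<Rightarrow> bool" where
  "wts_recognizable \<Sigma> L \<longleftrightarrow>
     (\<exists>W :: ('s, nat) wang_tile_system.
        wang_tile_system W \<and> wts_alphabet W = \<Sigma> \<and> wts_language W = L)"


section \<open>Pseudo-picture graphs\<close>

text \<open>Only the values of \<open>label\<close> on \<open>nodes\<close> are relevant.\<close>

record ('v, 's) pgraph =
  nodes :: "'v set"
  vedges :: "('v \<times> 'v) set"
  hedges :: "('v \<times> 'v) set"
  label :: "'v \<Rightarrow> 's"

definition pseudo_picture_graph :: "'s set \<Rightarrow> ('v, 's) pgraph \<Rightarrow> bool" where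
  "pseudo_picture_graph \<Sigma> G \<longleftrightarrow>
     finite (nodes G) \<and> vedges G \<inter> hedges G = {} \<and>
     vedges G \<subseteq> nodes G \<times> nodes G \<and> hedges G \<subseteq> nodes G \<times> nodes G \<and>
     label G ` nodes G \<subseteq> \<Sigma>"

definition induced_graph :: "('v, 's) pgraph \<Rightarrow> 'v set \<Rightarrow> ('v, 's) pgraph" where
  "induced_graph G S =
     \<lparr>nodes = S, vedges = vedges G \<inter> S \<times> S, hedges = hedges G \<inter> S \<times> S, label = label G\<rparr>"

definition full_subgraph :: "('v, 's) pgraph \<Rightarrow> ('v, 's) pgraph \<Rightarrow> bool" where
  "full_subgraph H G \<longleftrightarrow>
     nodes H \<subseteq> nodes G \<and>
     vedges H = vedges G \<inter> nodes H \<times> nodes H \<and>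
     hedges H = hedges G \<inter> nodes H \<times> nodes H \<and>
     (\<forall>x \<in> nodes H. label H x = label G x)"

text \<open>
  Edge directions are ignored.  The empty graph counts as connected, so that a hyperedge may
  have an empty set of incoming active nodes.
\<close>

definition connected_graph :: "('v, 's) pgraph \<Rightarrow> bool" where
  "connected_graph G \<longleftrightarrow>
     (let R = vedges G \<union> hedges G in \<forall>x \<in> nodes G. \<forall>y \<in> nodes G. (x, y) \<in> (R \<union> R\<inverse>)\<^sup>*)"

definition graph_isomorphism ::
    "('v \<Rightarrow> 'u) \<Rightarrow> ('v, 's) pgraph \<Rightarrow> ('u, 's) pgraph \<Rightarrow> bool" where
  "graph_isomorphism h G H \<longleftrightarrow>
     bij_betw h (nodes G) (nodes H) \<and>
     (\<forall>x \<in> nodes G. \<forall>y \<in> nodes G.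
        ((x, y) \<in> vedges G \<longleftrightarrow> (h x, h y) \<in> vedges H) \<and>
        ((x, y) \<in> hedges G \<longleftrightarrow> (h x, h y) \<in> hedges H)) \<and>
     (\<forall>x \<in> nodes G. label H (h x) = label G x)"

definition grid_coordinates ::
    "nat \<Rightarrow> nat \<Rightarrow> ('v, 's) pgraph \<Rightarrow> ('v \<Rightarrow> nat \<times> nat) \<Rightarrow> bool" where
  "grid_coordinates n m G f \<longleftrightarrow>
     bij_betw f (nodes G) ({..<n} \<times> {..<m}) \<and>
     (\<forall>x \<in> nodes G. \<forall>y \<in> nodes G.
        ((x, y) \<in> vedges G \<longleftrightarrow> (fst (f x) + 1, snd (f x)) = f y) \<and>
        ((x, y) \<in> hedges G \<longleftrightarrow> (fst (f x), snd (f x) + 1) = f y))"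

definition picture_graph :: "'s set \<Rightarrow> ('v, 's) pgraph \<Rightarrow> bool" where
  "picture_graph \<Sigma> G \<longleftrightarrow>
     pseudo_picture_graph \<Sigma> G \<and> (\<exists>n m f. 0 < n \<and> 0 < m \<and> grid_coordinates n m G f)"

text \<open>
  \<open>represents_picture G p\<close> says that \<open>p\<close> is the picture \<open>p(G)\<close> of the picture graph \<open>G\<close>.  The
  coordinate map of a picture graph is unique, so \<open>p\<close> is determined by \<open>G\<close>.
\<close>

definition represents_picture :: "('v, 's) pgraph \<Rightarrow> 's mat \<Rightarrow> bool" where
  "represents_picture G p \<longleftrightarrow>
     (\<exists>n m f. 0 < n \<and> 0 < m \<and> grid_coordinates n m G f \<and>
        p = mat n m (\<lambda>ij. label G (inv_into (nodes G) f ij)))"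

text \<open>
  The surrounding picture graph takes its nodes from the same type, which is therefore meant to
  be infinite; configurations below use such a type.
\<close>

definition subgrid :: "'s set \<Rightarrow> ('v, 's) pgraph \<Rightarrow> bool" where
  "subgrid \<Sigma> M \<longleftrightarrow>
     pseudo_picture_graph \<Sigma> M \<and> connected_graph M \<and>
     (\<exists>G. picture_graph \<Sigma> G \<and> full_subgraph M G)"


section \<open>SA-hypergraph automata\<close>

text \<open>
  The node set of the hypergraph is the node set of the underlying graph.  The pair
  \<open>active A e = (Q1, Q2)\<close> consists of the incoming and the outgoing active nodes of \<open>e\<close>.
\<close>

record ('n, 'e, 's) sa_automaton =
  alphabet :: "'s set"
  hyperedges :: "'e set"
  incidence :: "'e \<Rightarrow> 'n set"
  active :: "'e \<Rightarrow> 'n set \<times> 'n set"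
  underlying :: "('n, 's) pgraph"
  initial_hyperedges :: "'e set"

definition intersection_nodes :: "('n, 'e, 's) sa_automaton \<Rightarrow> 'e \<Rightarrow> 'n set" where
  "intersection_nodes A e =
     {x \<in> nodes (underlying A). \<exists>e' \<in> hyperedges A - {e}. x \<in> incidence A e \<inter> incidence A e'}"

definition incoming :: "('n, 'e, 's) sa_automaton \<Rightarrow> 'e \<Rightarrow> 'n set" where
  "incoming A e = fst (active A e)"

definition outgoing :: "('n, 'e, 's) sa_automaton \<Rightarrow> 'e \<Rightarrow> 'n set" where
  "outgoing A e = snd (active A e)"

definition hyperedge_graph :: "('n, 'e, 's) sa_automaton \<Rightarrow> 'e \<Rightarrow> ('n, 's) pgraph" where
  "hyperedge_graph A e = induced_graph (underlying A) (incidence A e)"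

definition sa_hypergraph_automaton :: "('n, 'e, 's) sa_automaton \<Rightarrow> bool" where
  "sa_hypergraph_automaton A \<longleftrightarrow>
     finite (alphabet A) \<and>
     pseudo_picture_graph (alphabet A) (underlying A) \<and>
     finite (hyperedges A) \<and>
     initial_hyperedges A \<subseteq> hyperedges A \<and>
     (\<forall>e \<in> hyperedges A.
        incidence A e \<subseteq> nodes (underlying A) \<and>
        incoming A e \<subseteq> intersection_nodes A e \<and>
        outgoing A e \<subseteq> intersection_nodes A e \<and>
        connected_graph (hyperedge_graph A e) \<and>
        connected_graph (induced_graph (hyperedge_graph A e) (incoming A e)))"

text \<open>
  The nodes of a configuration are taken from \<^typ>\<open>'n + nat\<close>: \<open>Inl x\<close> is the node \<open>x\<close> of the
  underlying graph itself (as used in initial configurations), and the second summand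
  guarantees that fresh nodes are always available, even if \<^typ>\<open>'n\<close> is finite.
\<close>

type_synonym ('n, 's) configuration =
  "('n + nat, 's) pgraph \<times> ('n + nat) set \<times> ('n + nat \<Rightarrow> 'n)"

definition is_configuration ::
    "('n, 'e, 's) sa_automaton \<Rightarrow> ('n, 's) configuration \<Rightarrow> bool" where
  "is_configuration A = (\<lambda>(M, Act, g).
     subgrid (alphabet A) M \<and> Act \<subseteq> nodes M \<and>
     g ` nodes M \<subseteq> nodes (underlying A) \<and>
     (\<forall>x \<in> nodes M. label M x = label (underlying A) (g x)))"

text \<open>
  In a transition by \<open>e\<close>, the active nodes \<open>P\<close> are glued to the incoming nodes of \<open>e\<close>, and
  \<open>copy\<close> maps the remaining nodes of \<open>e\<close> to their fresh copies.
\<close>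

definition transition_by :: "('n, 'e, 's) sa_automaton \<Rightarrow> 'e
    \<Rightarrow> ('n, 's) configuration \<Rightarrow> ('n, 's) configuration \<Rightarrow> bool" where
  "transition_by A e = (\<lambda>(M1, Act1, g1) (M2, Act2, g2).
     is_configuration A (M1, Act1, g1) \<and> is_configuration A (M2, Act2, g2) \<and>
     (\<exists>P copy. let New = incidence A e - incoming A e; N' = copy ` New in
        P \<noteq> {} \<and> P \<subseteq> Act1 \<and>
        graph_isomorphism g1 (induced_graph M1 P)
          (induced_graph (hyperedge_graph A e) (incoming A e)) \<and>
        inj_on copy New \<and> N' \<inter> nodes M1 = {} \<and>
        nodes M2 = nodes M1 \<union> N' \<and>
        (\<forall>x \<in> nodes M1. g2 x = g1 x) \<and>
        (\<forall>x \<in> New. g2 (copy x) = x) \<and>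
        vedges M2 = vedges M1 \<union>
          {(x, y). x \<in> P \<union> N' \<and> y \<in> P \<union> N' \<and> (g2 x, g2 y) \<in> vedges (underlying A)} \<and>
        hedges M2 = hedges M1 \<union>
          {(x, y). x \<in> P \<union> N' \<and> y \<in> P \<union> N' \<and> (g2 x, g2 y) \<in> hedges (underlying A)} \<and>
        (\<forall>x \<in> nodes M2. label M2 x = label (underlying A) (g2 x)) \<and>
        Act2 = (Act1 - P) \<union> copy ` (New \<inter> outgoing A e)))"

definition transition :: "('n, 'e, 's) sa_automaton
    \<Rightarrow> ('n, 's) configuration \<Rightarrow> ('n, 's) configuration \<Rightarrow> bool" where
  "transition A C D \<longleftrightarrow> (\<exists>e \<in> hyperedges A. transition_by A e C D)"

definition rename_graph :: "('v \<Rightarrow> 'u) \<Rightarrow> ('u \<Rightarrow> 'v) \<Rightarrow> ('v, 's) pgraph \<Rightarrow> ('u, 's) pgraph" where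
  "rename_graph h h' G =
     \<lparr>nodes = h ` nodes G, vedges = map_prod h h ` vedges G,
      hedges = map_prod h h ` hedges G, label = label G \<circ> h'\<rparr>"

text \<open>
  The configuration \<open>(G\<^sub>e, O\<^sub>e, id)\<close>, up to the embedding \<open>Inl\<close> of nodes.
\<close>

definition initial_configuration ::
    "('n, 'e, 's) sa_automaton \<Rightarrow> 'e \<Rightarrow> ('n, 's) configuration" where
  "initial_configuration A e =
     (rename_graph Inl projl (hyperedge_graph A e), Inl ` outgoing A e, projl)"

definition accepted_graphs :: "('n, 'e, 's) sa_automaton \<Rightarrow> ('n + nat, 's) pgraph set" where
  "accepted_graphs A =
     {M. picture_graph (alphabet A) M \<and>
         (\<exists>e \<in> initial_hyperedges A. \<exists>g.
            (transition A)\<^sup>*\<^sup>* (initial_configuration A e) (M, {}, g))}"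

definition picture_language :: "('n, 'e, 's) sa_automaton \<Rightarrow> 's mat set" where
  "picture_language A = {p. \<exists>M \<in> accepted_graphs A. represents_picture M p}"


section \<open>Strong loops\<close>

datatype move = MDown | MUp | MRight | MLeft

text \<open>\<open>MDown\<close> and \<open>MRight\<close> traverse an edge along its direction, \<open>MUp\<close> and \<open>MLeft\<close> against it.\<close>

fun move_edge :: "('v, 's) pgraph \<Rightarrow> move \<Rightarrow> 'v \<Rightarrow> 'v \<Rightarrow> bool" where
  "move_edge G MDown x y \<longleftrightarrow> (x, y) \<in> vedges G"
| "move_edge G MUp x y \<longleftrightarrow> (y, x) \<in> vedges G"
| "move_edge G MRight x y \<longleftrightarrow> (x, y) \<in> hedges G"
| "move_edge G MLeft x y \<longleftrightarrow> (y, x) \<in> hedges G"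

fun walk :: "('v, 's) pgraph \<Rightarrow> 'v \<Rightarrow> move list \<Rightarrow> 'v \<Rightarrow> bool" where
  "walk G x [] y \<longleftrightarrow> x \<in> nodes G \<and> x = y"
| "walk G x (m # ms) y \<longleftrightarrow> (\<exists>z. move_edge G m x z \<and> walk G z ms y)"

definition balanced :: "move list \<Rightarrow> bool" where
  "balanced ms \<longleftrightarrow>
     count_list ms MRight = count_list ms MLeft \<and> count_list ms MDown = count_list ms MUp"

text \<open>
  A loop \<open>e\<^sub>0, \<dots>, e\<^sub>n\<close> has \<open>n \<ge> 1\<close>: a single hyperedge without any hand-over is not a loop.
\<close>

definition derivation_loop :: "('n, 'e, 's) sa_automaton \<Rightarrow> 'e list \<Rightarrow> bool" where
  "derivation_loop A es \<longleftrightarrow>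
     2 \<le> length es \<and> set es \<subseteq> hyperedges A \<and> hd es = last es \<and>
     (\<forall>i. Suc i < length es \<longrightarrow> outgoing A (es ! i) \<inter> incoming A (es ! Suc i) \<noteq> {})"

text \<open>
  With \<open>n = length es - 1\<close>, the closed walk consists of segments \<open>seg 0, \<dots>, seg n\<close>.  Segment
  \<open>seg i\<close> stays inside the graph of \<open>e\<^sub>i\<close> and runs from \<open>pt i\<close> to \<open>pt (Suc i)\<close>, where
  \<open>pt 0 = pt (Suc n)\<close> is the starting node and the walk passes from the graph of \<open>e\<^sub>i\<close> to that of
  the next hyperedge in the node \<open>pt (Suc i)\<close> of \<open>O\<^sub>i\<close>.
\<close>

definition strong_loop :: "('n, 'e, 's) sa_automaton \<Rightarrow> 'e list \<Rightarrow> bool" where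
  "strong_loop A es \<longleftrightarrow>
     derivation_loop A es \<and>
     (\<exists>(pt :: nat \<Rightarrow> 'n) (seg :: nat \<Rightarrow> move list).
        pt (length es) = pt 0 \<and>
        (\<forall>i. Suc i < length es \<longrightarrow>
           pt (Suc i) \<in> outgoing A (es ! i) \<inter> incoming A (es ! Suc i)) \<and>
        (\<forall>i < length es. walk (hyperedge_graph A (es ! i)) (pt i) (seg i) (pt (Suc i))) \<and>
        balanced (concat (map seg [0..<length es])))"

end

theory Submission
  imports Defs "HOL-Library.Product_Plus" "HOL-Library.Nat_Bijection"
begin

text \<open>
  A picture is accepted iff it is tiled by copies of hyperedge graphs in the way a derivation would
  do it: each cell is created by one copy and consumed by at most one later copy.  Writing into each
  cell its node, its creating and its consuming hyperedge makes this a local condition: since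
  hyperedge graphs are connected and embed into the grid, the cells of a copy are found by following
  edges, and a copy is determined by its hyperedge and its origin.  Two conditions are global.  That
  there is only one initial copy is enforced by marking at most one cell of the picture.  That the
  copies can be ordered in time means that the relation "creates a cell consumed by" is acyclic;
  a cycle yields a closed walk in the picture, hence a strong loop.
\<close>

section \<open>Local tilings\<close>

text \<open>Besides time, fullness shapes the local conditions. Adjacent cells of an accepted
  picture are joined by an edge, but a transition inserts edges only between cells of the copy that
  it adds. So the edge between two neighbours appears with the later of them, whose creator
  therefore contains both. \<open>compatible\<close> demands this, and it makes every intermediate
  graph of the rebuilt derivation a full subgraph of the picture, hence a subgrid. Given acyclicity,
  any linear extension of the relation is a derivation: a copy can be applied as soon as the
  creators of its incoming cells have been, because these cells have no other consumer. An ordinary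
  copy has to glue at least one cell and so has a predecessor; a minimal copy must be the initial
  one. The flag in \<open>creator\<close> separates two roles of an initial hyperedge, which may be
  applied again later as an ordinary one and then glues its incoming nodes instead of creating
  them.\<close>

definition local_run :: "'q set \<Rightarrow> ('q \<Rightarrow> 's) \<Rightarrow> (bool \<Rightarrow> 'q \<Rightarrow> 'q \<Rightarrow> bool) \<Rightarrow> (bool \<Rightarrow> 'q \<Rightarrow> bool)
    \<Rightarrow> (bool \<Rightarrow> 'q \<Rightarrow> bool) \<Rightarrow> 's mat \<Rightarrow> (nat \<times> nat \<Rightarrow> 'q) \<Rightarrow> bool" where
  "local_run Q lab R F B p m \<longleftrightarrow> (\<forall>i<dim_row p. \<forall>j<dim_col p.
     m (i, j) \<in> Q \<and> lab (m (i, j)) = p $$ (i, j) \<and>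
     (if Suc i < dim_row p then R True (m (i, j)) (m (Suc i, j)) else F True (m (i, j))) \<and>
     (if Suc j < dim_col p then R False (m (i, j)) (m (i, Suc j)) else F False (m (i, j))) \<and>
     (i = 0 \<longrightarrow> B True (m (i, j))) \<and> (j = 0 \<longrightarrow> B False (m (i, j))))"

text \<open>
  A tile records the states of a cell and of its neighbours; the colour of a side encodes the pair
  of states that meet there.
\<close>

lemma wts_recognizable_local:
  fixes lab :: "'q \<Rightarrow> 's"
  assumes "finite \<Sigma>" "finite Q" and lab: "lab ` Q \<subseteq> \<Sigma>"
  shows "wts_recognizable \<Sigma> {p \<in> pictures \<Sigma>. \<exists>m. local_run Q lab R F B p m}"
proof -
  obtain enc :: "'q \<times> 'q \<Rightarrow> nat" where enc: "inj_on enc (Q \<times> Q)"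
    using finite_imp_inj_to_nat_seg[of "Q \<times> Q"] \<open>finite Q\<close> by auto
  define mk :: "'q option \<Rightarrow> 'q option \<Rightarrow> 'q option \<Rightarrow> 'q option \<Rightarrow> 'q \<Rightarrow> ('s, nat) wang_tile"
    where "mk n e s w q = \<lparr>north = map_option (\<lambda>a. enc (a, q)) n,
      east = map_option (\<lambda>a. enc (q, a)) e, south = map_option (\<lambda>a. enc (q, a)) s,
      west = map_option (\<lambda>a. enc (a, q)) w, tile_label = lab q\<rparr>" for n e s w q
  \<comment> \<open>Every adjacent pair is tested once, by its northern or western tile; towards
    north and west a tile only remembers a state. \<open>None\<close> on a side stands for the
    border and triggers \<open>B\<close> or \<open>F\<close>.\<close>
  define ok where "ok n e s w q \<longleftrightarrow> q \<in> Q \<and>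
      (case n of None \<Rightarrow> B True q | Some a \<Rightarrow> a \<in> Q) \<and>
      (case w of None \<Rightarrow> B False q | Some a \<Rightarrow> a \<in> Q) \<and>
      (case s of None \<Rightarrow> F True q | Some a \<Rightarrow> a \<in> Q \<and> R True q a) \<and>
      (case e of None \<Rightarrow> F False q | Some a \<Rightarrow> a \<in> Q \<and> R False q a)" for n e s w q
  define W where "W = \<lparr>wts_alphabet = \<Sigma>, colours = enc ` (Q \<times> Q),
      tiles = {mk n e s w q | n e s w q. ok n e s w q}\<rparr>"
  let ?O = "insert None (Some ` Q)"
  have inO: "n \<in> ?O \<and> e \<in> ?O \<and> s \<in> ?O \<and> w \<in> ?O \<and> q \<in> Q" if "ok n e s w q" for n e s w q
    using that unfolding ok_def by (auto split: option.splits)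
  have "tiles W \<subseteq> (\<lambda>(n, e, s, w, q). mk n e s w q) ` (?O \<times> ?O \<times> ?O \<times> ?O \<times> Q)"
  proof
    fix t assume "t \<in> tiles W"
    then obtain n e s w q where t: "t = mk n e s w q" "ok n e s w q"
      unfolding W_def by auto
    show "t \<in> (\<lambda>(n, e, s, w, q). mk n e s w q) ` (?O \<times> ?O \<times> ?O \<times> ?O \<times> Q)"
      by (rule image_eqI[of _ _ "(n, e, s, w, q)"]) (use t inO[OF t(2)] in simp_all)
  qed
  then have "finite (tiles W)"
    by (rule finite_subset) (use \<open>finite Q\<close> in simp)
  moreover have "tile_label t \<in> \<Sigma> \<and>
      {north t, east t, south t, west t} \<subseteq> insert None (Some ` enc ` (Q \<times> Q))"
    if "t \<in> tiles W" for t
    using that lab inO unfolding W_def by (fastforce simp: mk_def)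
  ultimately have W: "wang_tile_system W"
    using assms unfolding wang_tile_system_def by (simp add: W_def)
  have "(\<exists>m. wts_tiling W p m) \<longleftrightarrow> (\<exists>m. local_run Q lab R F B p m)" if p: "p \<in> pictures \<Sigma>" for p
  proof
    let ?h = "dim_row p" and ?w = "dim_col p"
    assume "\<exists>m. local_run Q lab R F B p m"
    then obtain m where m: "\<And>i j. i < ?h \<Longrightarrow> j < ?w \<Longrightarrow> m (i, j) \<in> Q \<and> lab (m (i, j)) = p $$ (i, j) \<and>
       (if Suc i < dim_row p then R True (m (i, j)) (m (Suc i, j)) else F True (m (i, j))) \<and>
       (if Suc j < dim_col p then R False (m (i, j)) (m (i, Suc j)) else F False (m (i, j))) \<and>
       (i = 0 \<longrightarrow> B True (m (i, j))) \<and> (j = 0 \<longrightarrow> B False (m (i, j)))"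
      unfolding local_run_def by blast
    define n where "n i j = (if i = 0 then None else Some (m (i - 1, j)))" for i j :: nat
    define w where "w i j = (if j = 0 then None else Some (m (i, j - 1)))" for i j :: nat
    define s where "s i j = (if Suc i < ?h then Some (m (Suc i, j)) else None)" for i j :: nat
    define e where "e i j = (if Suc j < ?w then Some (m (i, Suc j)) else None)" for i j :: nat
    define t where "t = (\<lambda>(i, j). mk (n i j) (e i j) (s i j) (w i j) (m (i, j)))"
    have ok: "ok (n i j) (e i j) (s i j) (w i j) (m (i, j))" if "i < ?h" "j < ?w" for i j
    proof -
      have "i \<noteq> 0 \<Longrightarrow> m (i - 1, j) \<in> Q" "j \<noteq> 0 \<Longrightarrow> m (i, j - 1) \<in> Q"
        "Suc i < ?h \<Longrightarrow> m (Suc i, j) \<in> Q" "Suc j < ?w \<Longrightarrow> m (i, Suc j) \<in> Q"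
        using m that by auto
      then show ?thesis
        using m[OF that] unfolding ok_def n_def w_def s_def e_def by (auto split: if_splits)
    qed
    have "wts_tiling W p t"
      unfolding wts_tiling_def Let_def
    proof (intro conjI allI impI)
      fix i j assume ij: "i < ?h" "j < ?w"
      show "t (i, j) \<in> tiles W"
        using ok[OF ij] unfolding W_def t_def by simp blast
      show "tile_label (t (i, j)) = p $$ (i, j)"
        using m[OF ij] unfolding t_def mk_def by simp
    next
      fix i j assume ij: "Suc i < ?h \<and> j < ?w"
      then have "m (i, j) \<in> Q" "m (Suc i, j) \<in> Q" using m by auto
      then show "\<exists>c\<in>colours W. south (t (i, j)) = Some c \<and> north (t (Suc i, j)) = Some c"
        using ij unfolding W_def t_def mk_def s_def n_def by simp
    next
      fix i j assume ij: "i < ?h \<and> Suc j < ?w"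
      then have "m (i, j) \<in> Q" "m (i, Suc j) \<in> Q" using m by auto
      then show "\<exists>c\<in>colours W. east (t (i, j)) = Some c \<and> west (t (i, Suc j)) = Some c"
        using ij unfolding W_def t_def mk_def e_def w_def by simp
    qed (auto simp: t_def mk_def n_def s_def e_def w_def)
    then show "\<exists>m. wts_tiling W p m" by blast
  next
    let ?h = "dim_row p" and ?w = "dim_col p"
    assume "\<exists>m. wts_tiling W p m"
    then obtain t where "wts_tiling W p t" by blast
    note t = this[unfolded wts_tiling_def Let_def]
    have "\<forall>ij. \<exists>n e s w q. fst ij < ?h \<and> snd ij < ?w \<longrightarrow>
        ok n e s w q \<and> t ij = mk n e s w q \<and> lab q = p $$ ij"
    proof
      fix ij :: "nat \<times> nat"
      show "\<exists>n e s w q. fst ij < ?h \<and> snd ij < ?w \<longrightarrow>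
        ok n e s w q \<and> t ij = mk n e s w q \<and> lab q = p $$ ij"
      proof (cases "fst ij < ?h \<and> snd ij < ?w")
        case True
        then have "t ij \<in> tiles W" "tile_label (t ij) = p $$ ij"
          using t by (cases ij; simp)+
        then obtain n e s w q where "t ij = mk n e s w q" "ok n e s w q"
          unfolding W_def by auto
        then have "ok n e s w q \<and> t ij = mk n e s w q \<and> lab q = p $$ ij"
          using \<open>tile_label (t ij) = p $$ ij\<close> by (simp add: mk_def)
        then show ?thesis by blast
      qed auto
    qed
    then obtain n e s w q where nesw: "\<And>i j. i < ?h \<Longrightarrow> j < ?w \<Longrightarrow>
        ok (n (i, j)) (e (i, j)) (s (i, j)) (w (i, j)) (q (i, j)) \<and>
        t (i, j) = mk (n (i, j)) (e (i, j)) (s (i, j)) (w (i, j)) (q (i, j)) \<and>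
        lab (q (i, j)) = p $$ (i, j)"
      by (simp only: choice_iff fst_conv snd_conv) (metis fst_conv snd_conv)
    have "local_run Q lab R F B p q"
      unfolding local_run_def
    proof (intro allI impI conjI)
      fix i j assume ij: "i < ?h" "j < ?w"
      note a = nesw[OF ij]
      show "q (i, j) \<in> Q" "lab (q (i, j)) = p $$ (i, j)"
        using a unfolding ok_def by auto
      show "if Suc i < dim_row p then R True (q (i, j)) (q (Suc i, j)) else F True (q (i, j))"
      proof (cases "Suc i < ?h")
        case True
        note b = nesw[OF True ij(2)]
        obtain c where c: "south (t (i, j)) = Some c" "north (t (Suc i, j)) = Some c"
          using t True ij by blast
        then obtain x y where xy: "s (i, j) = Some x" "n (Suc i, j) = Some y"
          "enc (q (i, j), x) = enc (y, q (Suc i, j))"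
          using a b unfolding mk_def by auto
        \<comment> \<open>As \<open>enc\<close> is injective on \<open>Q \<times> Q\<close>, the
          common colour identifies the pairs: the state guessed for the southern neighbour is the
          one the tile below really has.\<close>
        then have "(q (i, j), x) = (y, q (Suc i, j))"
          using a b by (intro inj_onD[OF enc]) (auto simp: ok_def)
        then show ?thesis
          using a xy(1) True by (simp add: ok_def)
      next
        case False
        then have "?h - 1 = i" using ij by simp
        then have "south (t (i, j)) = None"
          using t ij by metis
        then show ?thesis using a False unfolding ok_def mk_def by auto
      qed
      show "if Suc j < dim_col p then R False (q (i, j)) (q (i, Suc j)) else F False (q (i, j))"
      proof (cases "Suc j < ?w")
        case True
        note b = nesw[OF ij(1) True]
        obtain c where c: "east (t (i, j)) = Some c" "west (t (i, Suc j)) = Some c"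
          using t True ij by blast
        then obtain x y where xy: "e (i, j) = Some x" "w (i, Suc j) = Some y"
          "enc (q (i, j), x) = enc (y, q (i, Suc j))"
          using a b unfolding mk_def by auto
        then have "(q (i, j), x) = (y, q (i, Suc j))"
          using a b by (intro inj_onD[OF enc]) (auto simp: ok_def)
        then show ?thesis
          using a xy(1) True by (simp add: ok_def)
      next
        case False
        then have "?w - 1 = j" using ij by simp
        then have "east (t (i, j)) = None"
          using t ij by metis
        then show ?thesis using a False unfolding ok_def mk_def by auto
      qed
      show "i = 0 \<Longrightarrow> B True (q (i, j))"
      proof -
        assume "i = 0"
        then have "north (t (i, j)) = None" using t ij by metis
        then show ?thesis using a unfolding ok_def mk_def by auto
      qed
      show "j = 0 \<Longrightarrow> B False (q (i, j))"
      proof -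
        assume "j = 0"
        then have "west (t (i, j)) = None" using t ij by metis
        then show ?thesis using a unfolding ok_def mk_def by auto
      qed
    qed
    then show "\<exists>m. local_run Q lab R F B p m" by blast
  qed
  then have "wts_language W = {p \<in> pictures \<Sigma>. \<exists>m. local_run Q lab R F B p m}"
    unfolding wts_language_def by (auto simp: W_def)
  then show ?thesis
    unfolding wts_recognizable_def using W by (intro exI[of _ W]) (simp add: W_def)
qed


section \<open>Tilings by occurrences of hyperedges\<close>

text \<open>A boolean for the direction lets each argument about adjacency be made once for vertical
  and horizontal edges.\<close>

definition edges :: "bool \<Rightarrow> ('v, 's) pgraph \<Rightarrow> ('v \<times> 'v) set" where
  "edges d G = (if d then vedges G else hedges G)"

definition step :: "bool \<Rightarrow> int \<times> int" where
  "step d = (if d then (1, 0) else (0, 1))"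

text \<open>Integer positions keep predecessors beyond the border, and origins of copies outside the
  picture, from being truncated.\<close>

definition rect :: "nat \<Rightarrow> nat \<Rightarrow> (int \<times> int) set" where
  "rect h w = {0..<int h} \<times> {0..<int w}"

text \<open>An equivalence, because configurations are full subgraphs: two nodes of a copy that come
  to lie side by side must be joined in the hyperedge graph.\<close>

definition grid_embedding :: "('v, 's) pgraph \<Rightarrow> ('v \<Rightarrow> int \<times> int) \<Rightarrow> bool" where
  "grid_embedding G c \<longleftrightarrow> inj_on c (nodes G) \<and>
     (\<forall>d. \<forall>x \<in> nodes G. \<forall>y \<in> nodes G. (x, y) \<in> edges d G \<longleftrightarrow> c y = c x + step d)"

text \<open>
  The creator \<open>(r, e)\<close> is a copy of the graph of \<open>e\<close>, which belongs to the initial configuration if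
  \<open>r\<close> holds.  All its nodes are then created by it, also the incoming ones.
\<close>

datatype ('n, 'e) cell =
  Cell (cell_node: 'n) (creator: "bool \<times> 'e") (consumer: "'e option")

text \<open>A consumer is stored without a flag, since the initial copy glues nothing: a cell
  belongs to a copy by consumption only if the flag of that copy is \<open>False\<close>.\<close>

definition participates :: "('n, 'e) cell \<Rightarrow> bool \<times> 'e \<Rightarrow> bool" where
  "participates a \<epsilon> \<longleftrightarrow> creator a = \<epsilon> \<or> \<not> fst \<epsilon> \<and> consumer a = Some (snd \<epsilon>)"

text \<open>The clauses mirror the rules of a derivation. A transition glues a nonempty set of cells
  and creates just the other nodes of its hyperedge; acceptance leaves no active node, so a cell has
  a consumer iff its node is outgoing in its creator. The embeddings are demanded so that each copy
  has coordinates.\<close>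

definition valid_cell :: "('n, 'e, 's) sa_automaton \<Rightarrow> ('n, 'e) cell \<Rightarrow> bool" where
  "valid_cell A a \<longleftrightarrow> (let e = snd (creator a) in
     e \<in> hyperedges A \<and> Ex (grid_embedding (hyperedge_graph A e)) \<and> cell_node a \<in> incidence A e \<and>
     (if fst (creator a) then e \<in> initial_hyperedges A
      else incoming A e \<noteq> {} \<and> cell_node a \<notin> incoming A e) \<and>
     (consumer a = None \<longleftrightarrow> cell_node a \<notin> outgoing A e)) \<and>
     (\<forall>e. consumer a = Some e \<longrightarrow> e \<in> hyperedges A \<and>
        Ex (grid_embedding (hyperedge_graph A e)) \<and> cell_node a \<in> incoming A e)"

text \<open>The second clause says that the edge between the cells was inserted along with one of
  them. The last two force a copy to continue along each edge of its graph; they range over the at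
  most two copies in which a cell takes part.\<close>

definition compatible ::
    "('n, 'e, 's) sa_automaton \<Rightarrow> bool \<Rightarrow> ('n, 'e) cell \<Rightarrow> ('n, 'e) cell \<Rightarrow> bool" where
  "compatible A d a b \<longleftrightarrow>
     (cell_node a, cell_node b) \<in> edges d (underlying A) \<and>
     (participates b (creator a) \<or> participates a (creator b)) \<and>
     (\<forall>\<epsilon> y. participates a \<epsilon> \<and> (cell_node a, y) \<in> edges d (hyperedge_graph A (snd \<epsilon>)) \<longrightarrow>
        cell_node b = y \<and> participates b \<epsilon>) \<and>
     (\<forall>\<epsilon> y. participates b \<epsilon> \<and> (y, cell_node b) \<in> edges d (hyperedge_graph A (snd \<epsilon>)) \<longrightarrow>
        cell_node a = y \<and> participates a \<epsilon>)"

text \<open>For cells of the last row or column: no copy may stick out of the picture.\<close>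

definition final_cell :: "('n, 'e, 's) sa_automaton \<Rightarrow> bool \<Rightarrow> ('n, 'e) cell \<Rightarrow> bool" where
  "final_cell A d a \<longleftrightarrow>
     (\<forall>\<epsilon> y. participates a \<epsilon> \<longrightarrow> (cell_node a, y) \<notin> edges d (hyperedge_graph A (snd \<epsilon>)))"

definition first_cell :: "('n, 'e, 's) sa_automaton \<Rightarrow> bool \<Rightarrow> ('n, 'e) cell \<Rightarrow> bool" where
  "first_cell A d a \<longleftrightarrow>
     (\<forall>\<epsilon> y. participates a \<epsilon> \<longrightarrow> (y, cell_node a) \<notin> edges d (hyperedge_graph A (snd \<epsilon>)))"

text \<open>One representative node is fixed per hyperedge. An initial copy creates all of its
  nodes, so its representative shows up as a marked cell, and bounding marked cells bounds initial
  copies.\<close>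

definition marked :: "('n, 'e, 's) sa_automaton \<Rightarrow> ('n, 'e) cell \<Rightarrow> bool" where
  "marked A a \<longleftrightarrow> fst (creator a) \<and>
     cell_node a = (SOME x. x \<in> incidence A (snd (creator a)))"

definition tiling ::
    "('n, 'e, 's) sa_automaton \<Rightarrow> nat \<Rightarrow> nat \<Rightarrow> (int \<times> int \<Rightarrow> ('n, 'e) cell) \<Rightarrow> bool" where
  "tiling A h w \<sigma> \<longleftrightarrow>
     (\<forall>p \<in> rect h w. valid_cell A (\<sigma> p)) \<and>
     (\<forall>d. \<forall>p \<in> rect h w. if p + step d \<in> rect h w then compatible A d (\<sigma> p) (\<sigma> (p + step d))
        else final_cell A d (\<sigma> p)) \<and>
     (\<forall>d. \<forall>p \<in> rect h w. p - step d \<notin> rect h w \<longrightarrow> first_cell A d (\<sigma> p)) \<and>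
     (\<forall>p \<in> rect h w. \<forall>q \<in> rect h w. marked A (\<sigma> p) \<and> marked A (\<sigma> q) \<longrightarrow> p = q)"

lemma finite_valid_cells:
  assumes "sa_hypergraph_automaton A"
  shows "finite {a. valid_cell A a}"
proof (rule finite_subset)
  let ?N = "nodes (underlying A)" and ?E = "hyperedges A"
  show "{a. valid_cell A a} \<subseteq>
      (\<lambda>(x, \<epsilon>, t). Cell x \<epsilon> t) ` (?N \<times> (UNIV \<times> ?E) \<times> insert None (Some ` ?E))"
  proof
    fix a :: "('a, 'b) cell" assume a: "a \<in> {a. valid_cell A a}"
    obtain x r e t where [simp]: "a = Cell x (r, e) t" by (cases a) auto
    have "x \<in> ?N" "e \<in> ?E" using a assms
      by (auto simp: valid_cell_def sa_hypergraph_automaton_def Let_def)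
    moreover have "t \<in> insert None (Some ` ?E)"
      using a by (cases t) (auto simp: valid_cell_def)
    ultimately show "a \<in> (\<lambda>(x, \<epsilon>, t). Cell x \<epsilon> t) ` (?N \<times> (UNIV \<times> ?E) \<times> insert None (Some ` ?E))"
      by (intro image_eqI[of _ _ "(x, (r, e), t)"]) auto
  qed
  show "finite ((\<lambda>(x, \<epsilon>, t). Cell x \<epsilon> t) ` (?N \<times> (UNIV \<times> ?E) \<times> insert None (Some ` ?E)))"
    using assms by (auto simp: sa_hypergraph_automaton_def pseudo_picture_graph_def)
qed

section \<open>Uniqueness of the marked cell as a local condition\<close>

lemma rect_int [simp]: "(int i, int j) \<in> rect h w \<longleftrightarrow> i < h \<and> j < w"
  by (simp add: rect_def)

lemma rect_cases:
  assumes "p \<in> rect h w"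
  obtains i j where "p = (int i, int j)" "i < h" "j < w"
  using assms unfolding rect_def by (auto elim!: nonneg_int_cases)

lemma int_plus_step:
  "(int i, int j) + step True = (int (Suc i), int j)"
  "(int i, int j) + step False = (int i, int (Suc j))"
  by (simp_all add: step_def)

lemma int_minus_step_in_rect:
  assumes "i < h" "j < w"
  shows "(int i, int j) - step d \<in> rect h w \<longleftrightarrow> (if d then i else j) \<noteq> 0"
  using assms by (cases d) (auto simp: step_def rect_def)

text \<open>After a value 1 the next value is strictly larger, and monotonicity prevents any return
  to 1.\<close>

lemma one_unique:
  fixes \<rho> :: "nat \<Rightarrow> nat"
  assumes "i < h" "i' < h" "\<rho> i = 1" "\<rho> i' = 1"
    and mono: "\<And>i. Suc i < h \<Longrightarrow> \<rho> i \<le> \<rho> (Suc i) \<and> \<not> (\<rho> i = 1 \<and> \<rho> (Suc i) = 1)"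
  shows "i = i'"
proof -
  have "1 < \<rho> k" if "i < k" "k < h" "\<rho> i = 1" for i k
    using that
  proof (induction k)
    case (Suc k)
    show ?case
    proof (cases "i = k")
      case True
      then show ?thesis using Suc.prems mono[of k] by auto
    next
      case False
      then show ?thesis using Suc mono[of k] by auto
    qed
  qed simp
  then show ?thesis
    using assms(1-4) by (metis less_irrefl nat_neq_iff)
qed

text \<open>
  The second component of a state compares row and column with those of the marked cell; since
  it takes the value \<open>(1, 1)\<close> at most once, at most one cell is marked.
\<close>

lemma wts_recognizable_tiling:
  assumes A: "sa_hypergraph_automaton A"
  shows "wts_recognizable (alphabet A) {p \<in> pictures (alphabet A).
    \<exists>\<sigma>. tiling A (dim_row p) (dim_col p) \<sigma> \<and> (\<forall>i<dim_row p. \<forall>j<dim_col p.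
      label (underlying A) (cell_node (\<sigma> (int i, int j))) = p $$ (i, j))}"
proof -
  define Q where "Q = {(a, u :: nat \<times> nat). valid_cell A a \<and> u \<in> {..2} \<times> {..2} \<and>
    (marked A a \<longrightarrow> u = (1, 1))}"
  \<comment> \<open>The values 0, 1, 2 mean before, at and after the marked row or column.
    Forbidding two consecutive ones keeps this row or column single.\<close>
  define inc where "inc x y \<longleftrightarrow> x \<le> y \<and> \<not> (x = 1 \<and> y = 1)" for x y :: nat
  define R where "R d x y \<longleftrightarrow> compatible A d (fst x) (fst y) \<and>
    (if d then inc (fst (snd x)) (fst (snd y)) \<and> snd (snd x) = snd (snd y)
     else fst (snd x) = fst (snd y) \<and> inc (snd (snd x)) (snd (snd y)))"
    for d and x y :: "('a, 'b) cell \<times> nat \<times> nat"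
  define F where "F d x \<longleftrightarrow> final_cell A d (fst x)" for d and x :: "('a, 'b) cell \<times> nat \<times> nat"
  define B where "B d x \<longleftrightarrow> first_cell A d (fst x)" for d and x :: "('a, 'b) cell \<times> nat \<times> nat"
  define lab where "lab x = label (underlying A) (cell_node (fst x))"
    for x :: "('a, 'b) cell \<times> nat \<times> nat"
  have "Q \<subseteq> {a. valid_cell A a} \<times> {..2} \<times> {..2}" unfolding Q_def by auto
  then have "finite Q"
    by (rule finite_subset) (simp add: finite_valid_cells[OF A])
  moreover have "lab ` Q \<subseteq> alphabet A"
  proof -
    have "label (underlying A) (cell_node a) \<in> alphabet A" if "valid_cell A a" for a
      using that A unfolding valid_cell_def Let_def sa_hypergraph_automaton_def
        pseudo_picture_graph_def by blast
    then show ?thesis unfolding lab_def Q_def by auto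
  qed
  moreover have "finite (alphabet A)" using A by (simp add: sa_hypergraph_automaton_def)
  ultimately have "wts_recognizable (alphabet A)
      {p \<in> pictures (alphabet A). \<exists>m. local_run Q lab R F B p m}"
    by (intro wts_recognizable_local)
  moreover have "(\<exists>m. local_run Q lab R F B p m) \<longleftrightarrow>
     (\<exists>\<sigma>. tiling A (dim_row p) (dim_col p) \<sigma> \<and> (\<forall>i<dim_row p. \<forall>j<dim_col p.
      label (underlying A) (cell_node (\<sigma> (int i, int j))) = p $$ (i, j)))" for p
  proof
    let ?h = "dim_row p" and ?w = "dim_col p"
    assume "\<exists>m. local_run Q lab R F B p m"
    then obtain m where "local_run Q lab R F B p m" by blast
    note m = this[unfolded local_run_def, rule_format]
    define u where "u ij = snd (m ij)" for ij
    have V: "inc (fst (u (i, j))) (fst (u (Suc i, j))) \<and> snd (u (Suc i, j)) = snd (u (i, j))"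
      if "Suc i < ?h" "j < ?w" for i j
      using m[of i j] that unfolding R_def u_def by simp
    have H: "fst (u (i, Suc j)) = fst (u (i, j)) \<and> inc (snd (u (i, j))) (snd (u (i, Suc j)))"
      if "i < ?h" "Suc j < ?w" for i j
      using m[of i j] that unfolding R_def u_def by simp
    \<comment> \<open>The row comparison is constant along a row, so column 0 represents it; dually,
      row 0 represents the column comparison. This reduces uniqueness to two one-dimensional
      sequences.\<close>
    have fst_u: "fst (u (i, j)) = fst (u (i, 0))" if "i < ?h" "j < ?w" for i j
      using that by (induction j) (use H in auto)
    have snd_u: "snd (u (i, j)) = snd (u (0, j))" if "i < ?h" "j < ?w" for i j
      using that by (induction i) (use V in auto)
    have uniq: "(i, j) = (i', j')" if ij: "i < ?h" "j < ?w" and ij': "i' < ?h" "j' < ?w"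
      and u: "u (i, j) = (1, 1)" "u (i', j') = (1, 1)" for i j i' j'
    proof -
      have pos: "0 < ?h" "0 < ?w" using ij by linarith+
      have "fst (u (i, 0)) = 1" "fst (u (i', 0)) = 1"
        using fst_u[OF ij] fst_u[OF ij'] u by simp_all
      with ij(1) ij'(1) have "i = i'"
        by (rule one_unique[of i ?h i' "\<lambda>i. fst (u (i, 0))"]) (use V pos in \<open>simp add: inc_def\<close>)
      moreover have "snd (u (0, j)) = 1" "snd (u (0, j')) = 1"
        using snd_u[OF ij] snd_u[OF ij'] u by simp_all
      with ij(2) ij'(2) have "j = j'"
        by (rule one_unique[of j ?w j' "\<lambda>j. snd (u (0, j))"]) (use H pos in \<open>simp add: inc_def\<close>)
      ultimately show ?thesis by simp
    qed
    define \<sigma> where "\<sigma> ij = fst (m (nat (fst ij), nat (snd ij)))" for ij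
    have \<sigma>_int: "\<sigma> (int i, int j) = fst (m (i, j))" for i j
      by (simp add: \<sigma>_def)
    have "tiling A ?h ?w \<sigma>"
      unfolding tiling_def
    proof (intro conjI ballI allI impI)
      fix p' d assume "p' \<in> rect ?h ?w"
      then obtain i j where p': "p' = (int i, int j)" and ij: "i < ?h" "j < ?w"
        by (rule rect_cases)
      note mij = m[OF ij]
      show "valid_cell A (\<sigma> p')"
        using mij unfolding p' \<sigma>_int Q_def by (simp add: case_prod_unfold)
      show "if p' + step d \<in> rect ?h ?w then compatible A d (\<sigma> p') (\<sigma> (p' + step d))
        else final_cell A d (\<sigma> p')"
        using mij ij unfolding p'
        by (cases d; simp only: int_plus_step \<sigma>_int rect_int; simp add: R_def F_def split: if_splits)
      show "first_cell A d (\<sigma> p')" if "p' - step d \<notin> rect ?h ?w"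
        using mij ij that unfolding p' \<sigma>_int
        by (cases d; simp add: int_minus_step_in_rect B_def)
    next
      fix p' q' assume p'_in: "p' \<in> rect ?h ?w" and q'_in: "q' \<in> rect ?h ?w"
        and mk: "marked A (\<sigma> p') \<and> marked A (\<sigma> q')"
      obtain i j where p': "p' = (int i, int j)" and ij: "i < ?h" "j < ?w"
        using p'_in by (rule rect_cases)
      obtain i' j' where q': "q' = (int i', int j')" and ij': "i' < ?h" "j' < ?w"
        using q'_in by (rule rect_cases)
      have "u (i, j) = (1, 1)" "u (i', j') = (1, 1)"
        using m[OF ij] m[OF ij'] mk unfolding p' q' \<sigma>_int u_def Q_def by (auto simp: case_prod_unfold)
      then show "p' = q'" using uniq[OF ij ij'] p' q' by simp
    qed
    moreover have "label (underlying A) (cell_node (\<sigma> (int i, int j))) = p $$ (i, j)"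
      if "i < ?h" "j < ?w" for i j
      using m[OF that] by (simp add: \<sigma>_int lab_def)
    ultimately show "\<exists>\<sigma>. tiling A ?h ?w \<sigma> \<and> (\<forall>i<?h. \<forall>j<?w.
      label (underlying A) (cell_node (\<sigma> (int i, int j))) = p $$ (i, j))"
      by blast
  next
    let ?h = "dim_row p" and ?w = "dim_col p"
    assume "\<exists>\<sigma>. tiling A ?h ?w \<sigma> \<and> (\<forall>i<?h. \<forall>j<?w.
      label (underlying A) (cell_node (\<sigma> (int i, int j))) = p $$ (i, j))"
    then obtain \<sigma> where \<sigma>: "tiling A ?h ?w \<sigma>" and lab: "\<And>i j. i < ?h \<Longrightarrow> j < ?w \<Longrightarrow>
      label (underlying A) (cell_node (\<sigma> (int i, int j))) = p $$ (i, j)"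
      by blast
    \<comment> \<open>If no cell is marked, \<open>p0\<close> is arbitrary and may lie outside the
      picture; comparing positions with it is monotone all the same.\<close>
    obtain p0 where p0: "\<And>q. q \<in> rect ?h ?w \<Longrightarrow> marked A (\<sigma> q) \<Longrightarrow> q = p0"
      using \<sigma> unfolding tiling_def by meson
    define cmp :: "int \<Rightarrow> int \<Rightarrow> nat" where "cmp x y = (if x < y then 0 else if x = y then 1 else 2)" for x y
    have inc_cmp: "inc (cmp (int k) x) (cmp (int (Suc k)) x)" for k x
      by (simp add: inc_def cmp_def)
    define m where "m = (\<lambda>(i, j). (\<sigma> (int i, int j), (cmp (int i) (fst p0), cmp (int j) (snd p0))))"
    have "local_run Q lab R F B p m"
      unfolding local_run_def
    proof (intro allI impI conjI)
      fix i j assume ij: "i < ?h" "j < ?w"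
      have p: "(int i, int j) \<in> rect ?h ?w" using ij by simp
      show "m (i, j) \<in> Q"
        using \<sigma> p p0[OF p] by (auto simp: tiling_def m_def Q_def cmp_def)
      show "lab (m (i, j)) = p $$ (i, j)"
        using lab[OF ij] by (simp add: lab_def m_def)
      have t: "if (int i, int j) + step d \<in> rect ?h ?w
        then compatible A d (\<sigma> (int i, int j)) (\<sigma> ((int i, int j) + step d))
        else final_cell A d (\<sigma> (int i, int j))"
        "(int i, int j) - step d \<notin> rect ?h ?w \<Longrightarrow> first_cell A d (\<sigma> (int i, int j))" for d
        using \<sigma> p unfolding tiling_def by blast+
      show "if Suc i < ?h then R True (m (i, j)) (m (Suc i, j)) else F True (m (i, j))"
        using t(1)[of True] ij unfolding int_plus_step rect_int
        by (simp add: m_def R_def F_def inc_cmp del: of_nat_Suc split: if_splits)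
      show "if Suc j < ?w then R False (m (i, j)) (m (i, Suc j)) else F False (m (i, j))"
        using t(1)[of False] ij unfolding int_plus_step rect_int
        by (simp add: m_def R_def F_def inc_cmp del: of_nat_Suc split: if_splits)
      show "i = 0 \<Longrightarrow> B True (m (i, j))" "j = 0 \<Longrightarrow> B False (m (i, j))"
        using t(2)[of True] t(2)[of False] unfolding int_minus_step_in_rect[OF ij]
        by (simp_all add: m_def B_def)
    qed
    then show "\<exists>m. local_run Q lab R F B p m" by blast
  qed
  ultimately show ?thesis by simp
qed


section \<open>From derivations to tilings\<close>

lemma edges_induced: "edges d (induced_graph G S) = edges d G \<inter> S \<times> S"
  by (simp add: edges_def induced_graph_def)

lemma nodes_hyperedge_graph [simp]: "nodes (hyperedge_graph A e) = incidence A e"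
  by (simp add: hyperedge_graph_def induced_graph_def)

lemma edges_hyperedge_graph:
  "edges d (hyperedge_graph A e) = edges d (underlying A) \<inter> incidence A e \<times> incidence A e"
  by (simp add: hyperedge_graph_def edges_induced)

lemma automaton_hyperedge:
  assumes "sa_hypergraph_automaton A" "e \<in> hyperedges A"
  shows "incidence A e \<subseteq> nodes (underlying A)" "incoming A e \<subseteq> incidence A e"
    "outgoing A e \<subseteq> incidence A e"
  using assms unfolding sa_hypergraph_automaton_def intersection_nodes_def by blast+

text \<open>Injectivity of \<open>k\<close> is implied by
  \<open>cell_node (\<kappa> (k y)) = y\<close>. No positions occur, as coordinates are available
  only once the derivation has ended.\<close>

definition is_copy :: "('n, 'e, 's) sa_automaton \<Rightarrow> ('v, 's) pgraph \<Rightarrow> ('v \<Rightarrow> ('n, 'e) cell)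
    \<Rightarrow> bool \<times> 'e \<Rightarrow> ('n \<Rightarrow> 'v) \<Rightarrow> bool" where
  "is_copy A M \<kappa> \<epsilon> k \<longleftrightarrow>
     (\<forall>y \<in> incidence A (snd \<epsilon>). k y \<in> nodes M \<and> cell_node (\<kappa> (k y)) = y \<and> participates (\<kappa> (k y)) \<epsilon>) \<and>
     (\<forall>d. \<forall>y \<in> incidence A (snd \<epsilon>). \<forall>z \<in> incidence A (snd \<epsilon>).
        (k y, k z) \<in> edges d M \<longleftrightarrow> (y, z) \<in> edges d (underlying A))"

text \<open>The invariant of a derivation: \<open>\<kappa>\<close> annotates each node with its
  history so far. Active nodes are the outgoing ones not yet consumed, and every copy that a node
  takes part in is completely present. The last clause says that there is one initial copy, in which
  a node occurs once; it will yield uniqueness of the marked cell.\<close>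

definition explains :: "('n, 'e, 's) sa_automaton \<Rightarrow> ('n, 's) configuration
    \<Rightarrow> ('n + nat \<Rightarrow> ('n, 'e) cell) \<Rightarrow> bool" where
  "explains A = (\<lambda>(M, Act, g) \<kappa>.
     (\<forall>v \<in> nodes M. let e = snd (creator (\<kappa> v)) in
        cell_node (\<kappa> v) = g v \<and> label M v = label (underlying A) (g v) \<and>
        e \<in> hyperedges A \<and> g v \<in> incidence A e \<and>
        (if fst (creator (\<kappa> v)) then e \<in> initial_hyperedges A
         else incoming A e \<noteq> {} \<and> g v \<notin> incoming A e) \<and>
        (\<forall>e'. consumer (\<kappa> v) = Some e' \<longrightarrow>
           e' \<in> hyperedges A \<and> g v \<in> incoming A e' \<and> g v \<in> outgoing A e)) \<and>
     Act = {v \<in> nodes M. g v \<in> outgoing A (snd (creator (\<kappa> v))) \<and> consumer (\<kappa> v) = None} \<and>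
     (\<forall>d. \<forall>(v, w) \<in> edges d M. v \<in> nodes M \<and> w \<in> nodes M \<and> (g v, g w) \<in> edges d (underlying A) \<and>
        (participates (\<kappa> w) (creator (\<kappa> v)) \<or> participates (\<kappa> v) (creator (\<kappa> w)))) \<and>
     (\<forall>v \<in> nodes M. \<forall>\<epsilon>. participates (\<kappa> v) \<epsilon> \<longrightarrow> (\<exists>k. is_copy A M \<kappa> \<epsilon> k \<and> k (g v) = v)) \<and>
     (\<forall>v \<in> nodes M. \<forall>w \<in> nodes M. fst (creator (\<kappa> v)) \<and> fst (creator (\<kappa> w)) \<longrightarrow>
        creator (\<kappa> v) = creator (\<kappa> w) \<and> (g v = g w \<longrightarrow> v = w)))"

lemma explains_initial:
  assumes A: "sa_hypergraph_automaton A" and e: "e \<in> initial_hyperedges A"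
  shows "\<exists>\<kappa>. explains A (initial_configuration A e) \<kappa>"
proof -
  have e': "e \<in> hyperedges A" using A e unfolding sa_hypergraph_automaton_def by blast
  note sub = automaton_hyperedge[OF A e']
  \<comment> \<open>All nodes, incoming ones included, count as created by the initial copy, and
    none has been consumed.\<close>
  define \<kappa> where "\<kappa> = (\<lambda>v :: 'a + nat. Cell (projl v) (True, e) (None :: 'b option))"
  define M :: "('a + nat, 'c) pgraph" where "M = rename_graph Inl projl (hyperedge_graph A e)"
  have nM: "nodes M = Inl ` incidence A e"
    by (simp add: M_def rename_graph_def)
  have eM: "edges d M = map_prod Inl Inl ` (edges d (underlying A) \<inter> incidence A e \<times> incidence A e)" for d
    by (auto simp: M_def rename_graph_def edges_def hyperedge_graph_def induced_graph_def)
  have lM: "label M v = label (underlying A) (projl v)" for v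
    by (simp add: M_def rename_graph_def hyperedge_graph_def induced_graph_def)
  have copy: "is_copy A M \<kappa> (True, e) Inl"
    unfolding is_copy_def by (auto simp: nM eM \<kappa>_def participates_def)
  have part: "participates (\<kappa> v) \<epsilon> \<longleftrightarrow> \<epsilon> = (True, e)" for v \<epsilon>
    by (auto simp: \<kappa>_def participates_def)
  have "explains A (M, Inl ` outgoing A e, projl) \<kappa>"
    unfolding explains_def split_beta fst_conv snd_conv part
  proof (intro conjI)
    show "\<forall>v\<in>nodes M. \<forall>\<epsilon>. \<epsilon> = (True, e) \<longrightarrow> (\<exists>k. is_copy A M \<kappa> \<epsilon> k \<and> k (projl v) = v)"
      using copy by (auto simp: nM)
  qed (use e e' sub in \<open>auto simp: nM eM lM \<kappa>_def\<close>)
  then show ?thesis unfolding initial_configuration_def M_def by blast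
qed

text \<open>A transition changes the history of the glued nodes only, by giving them a consumer, and
  adds no edge between old nodes. So earlier copies stay intact, and just the copy being added has
  to be examined.\<close>

lemma explains_transition:
  assumes A: "sa_hypergraph_automaton A" and e: "e \<in> hyperedges A"
    and tr: "transition_by A e (M1, Act1, g1) (M2, Act2, g2)"
    and inv: "explains A (M1, Act1, g1) \<kappa>"
  shows "\<exists>\<kappa>'. explains A (M2, Act2, g2) \<kappa>'"
proof -
  let ?U = "underlying A"
  note sub = automaton_hyperedge[OF A e]
  define New where "New = incidence A e - incoming A e"
  obtain P cp where P: "P \<noteq> {}" "P \<subseteq> Act1"
    and iso: "graph_isomorphism g1 (induced_graph M1 P)
          (induced_graph (hyperedge_graph A e) (incoming A e))"
    and cp: "inj_on cp New" "cp ` New \<inter> nodes M1 = {}"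
    and nM2: "nodes M2 = nodes M1 \<union> cp ` New"
    and g2: "\<And>x. x \<in> nodes M1 \<Longrightarrow> g2 x = g1 x" "\<And>x. x \<in> New \<Longrightarrow> g2 (cp x) = x"
    and v2: "vedges M2 = vedges M1 \<union> {(x, y). x \<in> P \<union> cp ` New \<and> y \<in> P \<union> cp ` New \<and> (g2 x, g2 y) \<in> vedges ?U}"
    and h2: "hedges M2 = hedges M1 \<union> {(x, y). x \<in> P \<union> cp ` New \<and> y \<in> P \<union> cp ` New \<and> (g2 x, g2 y) \<in> hedges ?U}"
    and lab: "\<And>x. x \<in> nodes M2 \<Longrightarrow> label M2 x = label ?U (g2 x)"
    and Act2: "Act2 = (Act1 - P) \<union> cp ` (New \<inter> outgoing A e)"
    using tr unfolding transition_by_def Let_def prod.case New_def[symmetric]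
    by (elim conjE exE, intro that) (assumption | (drule (1) bspec, assumption))+
  have e2: "edges d M2 = edges d M1 \<union>
      {(x, y). x \<in> P \<union> cp ` New \<and> y \<in> P \<union> cp ` New \<and> (g2 x, g2 y) \<in> edges d ?U}" for d
    using v2 h2 by (auto simp: edges_def)
  have Act1: "Act1 = {v \<in> nodes M1. g1 v \<in> outgoing A (snd (creator (\<kappa> v))) \<and> consumer (\<kappa> v) = None}"
    using inv unfolding explains_def by simp
  then have PM: "P \<subseteq> nodes M1" and Pcons: "\<And>v. v \<in> P \<Longrightarrow> consumer (\<kappa> v) = None"
    using P by blast+
  have bij: "bij_betw g1 P (incoming A e)"
    using iso by (simp add: graph_isomorphism_def induced_graph_def)
  have gP: "g1 v \<in> incoming A e" if "v \<in> P" for v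
    using bij that by (auto simp: bij_betw_def)
  have iso_e: "(x, y) \<in> edges d M1 \<longleftrightarrow> (g1 x, g1 y) \<in> edges d ?U" if "x \<in> P" "y \<in> P" for d x y
  proof -
    have "(x, y) \<in> edges d (induced_graph M1 P) \<longleftrightarrow>
        (g1 x, g1 y) \<in> edges d (induced_graph (hyperedge_graph A e) (incoming A e))"
      using iso that unfolding graph_isomorphism_def edges_def by (simp add: induced_graph_def)
    then show ?thesis
      using that gP sub by (auto simp: edges_induced edges_hyperedge_graph)
  qed
  have nd: "cell_node (\<kappa> v) = g1 v" "label M1 v = label ?U (g1 v)"
    "snd (creator (\<kappa> v)) \<in> hyperedges A" "g1 v \<in> incidence A (snd (creator (\<kappa> v)))"
    "if fst (creator (\<kappa> v)) then snd (creator (\<kappa> v)) \<in> initial_hyperedges A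
     else incoming A (snd (creator (\<kappa> v))) \<noteq> {} \<and> g1 v \<notin> incoming A (snd (creator (\<kappa> v)))"
    "consumer (\<kappa> v) = Some e' \<Longrightarrow>
           e' \<in> hyperedges A \<and> g1 v \<in> incoming A e' \<and> g1 v \<in> outgoing A (snd (creator (\<kappa> v)))"
    if "v \<in> nodes M1" for v e'
    using inv that unfolding explains_def Let_def split_beta fst_conv snd_conv by blast+
  have ed: "v \<in> nodes M1" "w \<in> nodes M1" "(g1 v, g1 w) \<in> edges d ?U"
    "participates (\<kappa> w) (creator (\<kappa> v)) \<or> participates (\<kappa> v) (creator (\<kappa> w))"
    if vw: "(v, w) \<in> edges d M1" for v w d
  proof -
    have "\<forall>p\<in>edges d M1. fst p \<in> nodes M1 \<and> snd p \<in> nodes M1 \<and>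
        (g1 (fst p), g1 (snd p)) \<in> edges d ?U \<and>
        (participates (\<kappa> (snd p)) (creator (\<kappa> (fst p))) \<or>
         participates (\<kappa> (fst p)) (creator (\<kappa> (snd p))))"
      using inv unfolding explains_def split_beta fst_conv snd_conv by blast
    from bspec[OF this vw] show "v \<in> nodes M1" "w \<in> nodes M1" "(g1 v, g1 w) \<in> edges d ?U"
      "participates (\<kappa> w) (creator (\<kappa> v)) \<or> participates (\<kappa> v) (creator (\<kappa> w))"
      by simp_all
  qed
  have copy: "\<exists>k. is_copy A M1 \<kappa> \<epsilon> k \<and> k (g1 v) = v" if "v \<in> nodes M1" "participates (\<kappa> v) \<epsilon>" for v \<epsilon>
    using inv that unfolding explains_def prod.case by blast
  have root: "creator (\<kappa> v) = creator (\<kappa> w) \<and> (g1 v = g1 w \<longrightarrow> v = w)"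
    if "v \<in> nodes M1" "w \<in> nodes M1" "fst (creator (\<kappa> v))" "fst (creator (\<kappa> w))" for v w
    using inv that unfolding explains_def by simp
  \<comment> \<open>Setting the consumer overwrites nothing: nodes of \<open>P\<close> were active,
    so their consumer was \<open>None\<close>.\<close>
  define \<kappa>' where "\<kappa>' v = (if v \<in> P then Cell (g1 v) (creator (\<kappa> v)) (Some e)
      else if v \<in> nodes M1 then \<kappa> v else Cell (g2 v) (False, e) None)" for v
  have old: "creator (\<kappa>' v) = creator (\<kappa> v)" "cell_node (\<kappa>' v) = g1 v"
    "participates (\<kappa> v) \<epsilon> \<Longrightarrow> participates (\<kappa>' v) \<epsilon>" if "v \<in> nodes M1" for v \<epsilon>
    using that nd(1) Pcons by (auto simp: \<kappa>'_def participates_def)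
  have P': "participates (\<kappa>' v) (False, e)" "consumer (\<kappa>' v) = Some e" if "v \<in> P" for v
    using that by (simp_all add: \<kappa>'_def participates_def)
  have cp_notin: "cp x \<notin> nodes M1" "cp x \<notin> P" if "x \<in> New" for x
    using that cp(2) PM by blast+
  have new: "\<kappa>' (cp x) = Cell x (False, e) None" if "x \<in> New" for x
    using cp_notin[OF that] g2(2)[OF that] by (simp add: \<kappa>'_def)
  \<comment> \<open>An edge that the transition asks for inside \<open>P\<close> exists already,
    because \<open>g1\<close> is an isomorphism on \<open>P\<close>.\<close>
  have old_e: "(v, w) \<in> edges d M2 \<longleftrightarrow> (v, w) \<in> edges d M1" if "v \<in> nodes M1" "w \<in> nodes M1" for v w d
    using that iso_e g2(1) cp(2) PM unfolding e2 by auto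
  \<comment> \<open>The new copy: glued nodes stand for incoming nodes, fresh nodes for all
    others.\<close>
  define k where "k y = (if y \<in> incoming A e then inv_into P g1 y else cp y)" for y
  have k_in: "k y \<in> P" "g1 (k y) = y" if "y \<in> incoming A e" for y
    using that bij by (simp_all add: k_def bij_betw_def f_inv_into_f inv_into_into)
  have k_new: "k y = cp y" if "y \<in> New" for y
    using that by (simp add: k_def New_def)
  have k_g2: "k y \<in> P \<union> cp ` New \<and> g2 (k y) = y \<and> participates (\<kappa>' (k y)) (False, e) \<and> cell_node (\<kappa>' (k y)) = y"
    if "y \<in> incidence A e" for y
  proof (cases "y \<in> incoming A e")
    case True
    then show ?thesis using k_in[OF True] P' old PM g2(1) by auto
  next
    case False
    then have "y \<in> New" using that by (simp add: New_def)
    then show ?thesis using k_new new g2(2) by (simp add: participates_def)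
  qed
  have k_copy: "is_copy A M2 \<kappa>' (False, e) k"
    unfolding is_copy_def snd_conv
  proof (intro conjI allI ballI)
    fix d y z assume yz: "y \<in> incidence A e" "z \<in> incidence A e"
    show "((k y, k z) \<in> edges d M2) = ((y, z) \<in> edges d ?U)"
    proof
      assume "(k y, k z) \<in> edges d M2"
      then consider "(k y, k z) \<in> edges d M1" | "(g2 (k y), g2 (k z)) \<in> edges d ?U"
        unfolding e2 by auto
      then show "(y, z) \<in> edges d ?U"
      proof cases
        case 1
        then show ?thesis using ed[OF 1] k_g2[OF yz(1)] k_g2[OF yz(2)] g2(1) by metis
      qed (use k_g2 yz in simp)
    next
      assume "(y, z) \<in> edges d ?U"
      then show "(k y, k z) \<in> edges d M2"
        unfolding e2 using k_g2[OF yz(1)] k_g2[OF yz(2)] by simp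
    qed
  qed (use k_g2 nM2 PM in auto)
  have k_inv: "k (g2 v) = v" if "v \<in> P \<union> cp ` New" for v
  proof (cases "v \<in> P")
    case True
    then show ?thesis using bij gP g2(1) PM by (auto simp: k_def bij_betw_def inv_into_f_f)
  next
    case False
    then show ?thesis using that g2(2) k_new by auto
  qed
  have copy_mono: "is_copy A M2 \<kappa>' \<epsilon> k'" if "is_copy A M1 \<kappa> \<epsilon> k'" for \<epsilon> k'
    unfolding is_copy_def
  proof (intro conjI ballI allI)
    fix y z d assume yz: "y \<in> incidence A (snd \<epsilon>)" "z \<in> incidence A (snd \<epsilon>)"
    then have "k' y \<in> nodes M1" "k' z \<in> nodes M1" using that unfolding is_copy_def by blast+
    then show "((k' y, k' z) \<in> edges d M2) = ((y, z) \<in> edges d ?U)"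
      using that yz old_e unfolding is_copy_def by blast
  next
    fix y assume "y \<in> incidence A (snd \<epsilon>)"
    then have y: "k' y \<in> nodes M1" "cell_node (\<kappa> (k' y)) = y" "participates (\<kappa> (k' y)) \<epsilon>"
      using that unfolding is_copy_def by blast+
    show "k' y \<in> nodes M2" "cell_node (\<kappa>' (k' y)) = y" "participates (\<kappa>' (k' y)) \<epsilon>"
      using y nM2 old(2,3)[OF y(1)] nd(1)[OF y(1)] by auto
  qed
  have "explains A (M2, Act2, g2) \<kappa>'"
    unfolding explains_def split_beta fst_conv snd_conv Let_def
  proof (intro conjI)
    show "\<forall>v\<in>nodes M2. cell_node (\<kappa>' v) = g2 v \<and> label M2 v = label ?U (g2 v) \<and>
       snd (creator (\<kappa>' v)) \<in> hyperedges A \<and> g2 v \<in> incidence A (snd (creator (\<kappa>' v))) \<and>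
       (if fst (creator (\<kappa>' v)) then snd (creator (\<kappa>' v)) \<in> initial_hyperedges A
        else incoming A (snd (creator (\<kappa>' v))) \<noteq> {} \<and> g2 v \<notin> incoming A (snd (creator (\<kappa>' v)))) \<and>
       (\<forall>e'. consumer (\<kappa>' v) = Some e' \<longrightarrow> e' \<in> hyperedges A \<and> g2 v \<in> incoming A e' \<and>
              g2 v \<in> outgoing A (snd (creator (\<kappa>' v))))"
    proof
      fix v assume v: "v \<in> nodes M2"
      show "cell_node (\<kappa>' v) = g2 v \<and> label M2 v = label ?U (g2 v) \<and>
       snd (creator (\<kappa>' v)) \<in> hyperedges A \<and> g2 v \<in> incidence A (snd (creator (\<kappa>' v))) \<and>
       (if fst (creator (\<kappa>' v)) then snd (creator (\<kappa>' v)) \<in> initial_hyperedges A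
        else incoming A (snd (creator (\<kappa>' v))) \<noteq> {} \<and> g2 v \<notin> incoming A (snd (creator (\<kappa>' v)))) \<and>
       (\<forall>e'. consumer (\<kappa>' v) = Some e' \<longrightarrow> e' \<in> hyperedges A \<and> g2 v \<in> incoming A e' \<and>
              g2 v \<in> outgoing A (snd (creator (\<kappa>' v))))"
      proof (cases "v \<in> nodes M1")
        case True
        have "consumer (\<kappa>' v) = Some e' \<Longrightarrow> e' \<in> hyperedges A \<and> g1 v \<in> incoming A e' \<and>
              g1 v \<in> outgoing A (snd (creator (\<kappa> v)))" for e'
          using nd(6)[OF True, of e'] P(2) gP e Act1 True
          by (cases "v \<in> P") (auto simp: \<kappa>'_def)
        then show ?thesis
          using nd[OF True] old[OF True] g2(1)[OF True] lab[OF v] by auto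
      next
        case False
        then obtain x where x: "x \<in> New" "v = cp x" using v nM2 by blast
        have "incoming A e \<noteq> {}" using P(1) gP by blast
        then show ?thesis
          using new[OF x(1)] g2(2)[OF x(1)] lab[OF v] e x unfolding New_def by simp
      qed
    qed
    show "Act2 = {v \<in> nodes M2. g2 v \<in> outgoing A (snd (creator (\<kappa>' v))) \<and> consumer (\<kappa>' v) = None}"
    proof (rule Set.set_eqI)
      fix v
      show "v \<in> Act2 \<longleftrightarrow> v \<in> {v \<in> nodes M2. g2 v \<in> outgoing A (snd (creator (\<kappa>' v))) \<and> consumer (\<kappa>' v) = None}"
      proof (cases "v \<in> nodes M1")
        case True
        then have "v \<in> Act2 \<longleftrightarrow> v \<in> Act1 - P" using cp_notin by (auto simp: Act2)
        then show ?thesis using True old(1)[OF True] g2(1)[OF True] P'(2)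
          by (cases "v \<in> P") (auto simp: nM2 Act1 \<kappa>'_def)
      next
        case False
        then have "v \<notin> Act1" using Act1 by blast
        show ?thesis
        proof (cases "v \<in> cp ` New")
          case True
          then obtain x where x: "x \<in> New" "v = cp x" by blast
          have "v \<in> cp ` (New \<inter> outgoing A e) \<longleftrightarrow> x \<in> outgoing A e"
            using x cp(1) by (auto simp: inj_on_def)
          then show ?thesis
            using \<open>v \<notin> Act1\<close> x new[OF x(1)] g2(2)[OF x(1)] by (simp add: Act2 nM2)
        next
          case F: False
          then show ?thesis using False \<open>v \<notin> Act1\<close> by (auto simp: Act2 nM2)
        qed
      qed
    qed
    show "\<forall>d. \<forall>p\<in>edges d M2. fst p \<in> nodes M2 \<and> snd p \<in> nodes M2 \<and> (g2 (fst p), g2 (snd p)) \<in> edges d ?U \<and>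
        (participates (\<kappa>' (snd p)) (creator (\<kappa>' (fst p))) \<or> participates (\<kappa>' (fst p)) (creator (\<kappa>' (snd p))))"
    proof (intro allI ballI)
      fix d p assume p2: "p \<in> edges d M2"
      obtain v w where [simp]: "p = (v, w)" by (cases p)
      have "v \<in> nodes M2 \<and> w \<in> nodes M2 \<and> (g2 v, g2 w) \<in> edges d ?U \<and>
        (participates (\<kappa>' w) (creator (\<kappa>' v)) \<or> participates (\<kappa>' v) (creator (\<kappa>' w)))"
      proof (cases "(v, w) \<in> edges d M1")
        case True
        note t = ed[OF True]
        then show ?thesis
          using old(1)[OF t(1)] old(1)[OF t(2)] g2(1)[OF t(1)] g2(1)[OF t(2)] nM2
            old(3)[OF t(1), of "creator (\<kappa> w)"] old(3)[OF t(2), of "creator (\<kappa> v)"] by auto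
      next
        case False
        then have vw: "v \<in> P \<union> cp ` New" "w \<in> P \<union> cp ` New" "(g2 v, g2 w) \<in> edges d ?U"
          using p2 by (auto simp: e2)
        have part: "participates (\<kappa>' z) (False, e)" if "z \<in> P \<union> cp ` New" for z
          using that P' new by (auto simp: participates_def)
        \<comment> \<open>A new edge has a fresh end, created by the new copy, in which the other
          end takes part too.\<close>
        have "\<not> (v \<in> P \<and> w \<in> P)"
          using False vw(3) iso_e[of v w d] g2(1)[of v] g2(1)[of w]
            subsetD[OF PM, of v] subsetD[OF PM, of w] by auto
        then have "v \<in> cp ` New \<or> w \<in> cp ` New" using vw by blast
        then show ?thesis
          using part[OF vw(1)] part[OF vw(2)] vw new nM2 PM by auto
      qed
      then show "fst p \<in> nodes M2 \<and> snd p \<in> nodes M2 \<and> (g2 (fst p), g2 (snd p)) \<in> edges d ?U \<and>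
        (participates (\<kappa>' (snd p)) (creator (\<kappa>' (fst p))) \<or> participates (\<kappa>' (fst p)) (creator (\<kappa>' (snd p))))"
        by simp
    qed
    show "\<forall>v\<in>nodes M2. \<forall>\<epsilon>. participates (\<kappa>' v) \<epsilon> \<longrightarrow> (\<exists>k. is_copy A M2 \<kappa>' \<epsilon> k \<and> k (g2 v) = v)"
    proof (intro ballI allI impI)
      fix v \<epsilon> assume v: "v \<in> nodes M2" and part: "participates (\<kappa>' v) \<epsilon>"
      show "\<exists>k. is_copy A M2 \<kappa>' \<epsilon> k \<and> k (g2 v) = v"
      proof (cases "v \<in> P \<union> cp ` New \<and> \<epsilon> = (False, e)")
        case True
        then show ?thesis using k_copy k_inv by blast
      next
        case False
        \<comment> \<open>A fresh node takes part in the new copy only, and a glued node gains no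
          other copy, so \<open>\<epsilon>\<close> was present before.\<close>
        then have "v \<in> nodes M1" "participates (\<kappa> v) \<epsilon>"
          using v part new nM2 PM unfolding participates_def
          by (auto simp: \<kappa>'_def prod_eq_iff split: if_splits)
        then show ?thesis using copy copy_mono g2(1) by metis
      qed
    qed
    show "\<forall>v\<in>nodes M2. \<forall>w\<in>nodes M2. fst (creator (\<kappa>' v)) \<and> fst (creator (\<kappa>' w)) \<longrightarrow>
        creator (\<kappa>' v) = creator (\<kappa>' w) \<and> (g2 v = g2 w \<longrightarrow> v = w)"
    proof (intro ballI impI)
      fix v w assume vw: "v \<in> nodes M2" "w \<in> nodes M2" "fst (creator (\<kappa>' v)) \<and> fst (creator (\<kappa>' w))"
      then have "v \<in> nodes M1" "w \<in> nodes M1"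
        using nM2 new by auto
      then show "creator (\<kappa>' v) = creator (\<kappa>' w) \<and> (g2 v = g2 w \<longrightarrow> v = w)"
        using root[of v w] vw(3) old(1) g2(1) by simp
    qed
  qed
  then show ?thesis by blast
qed

lemma explains_run:
  assumes A: "sa_hypergraph_automaton A" and e: "e \<in> initial_hyperedges A"
    and run: "(transition A)\<^sup>*\<^sup>* (initial_configuration A e) C"
  shows "\<exists>\<kappa>. explains A C \<kappa>"
  using run
proof (induction rule: rtranclp_induct)
  case base
  show ?case using explains_initial[OF A e] .
next
  case (step C D)
  then show ?case using explains_transition[OF A] unfolding transition_def
    by (cases C; cases D) blast
qed

text \<open>The history of the final graph is moved to positions by its grid coordinates; the global
  statement that copies are complete then gives the local conditions between neighbours.\<close>

lemma picture_language_tiling: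
  assumes A: "sa_hypergraph_automaton A" and p: "p \<in> picture_language A"
  shows "p \<in> pictures (alphabet A)"
    and "\<exists>\<sigma>. tiling A (dim_row p) (dim_col p) \<sigma> \<and> (\<forall>i<dim_row p. \<forall>j<dim_col p.
      label (underlying A) (cell_node (\<sigma> (int i, int j))) = p $$ (i, j))"
proof -
  let ?U = "underlying A"
  obtain M where M: "M \<in> accepted_graphs A" "represents_picture M p"
    using p unfolding picture_language_def by blast
  obtain h w f where hw: "0 < h" "0 < w" and f: "grid_coordinates h w M f"
    and p_eq: "p = mat h w (\<lambda>ij. label M (inv_into (nodes M) f ij))"
    using M(2) unfolding represents_picture_def by blast
  have dim: "dim_row p = h" "dim_col p = w" using p_eq by simp_all
  obtain e g where e: "e \<in> initial_hyperedges A"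
    and run: "(transition A)\<^sup>*\<^sup>* (initial_configuration A e) (M, {}, g)"
    and pic: "picture_graph (alphabet A) M"
    using M(1) unfolding accepted_graphs_def by blast
  obtain \<kappa> where ex: "explains A (M, {}, g) \<kappa>"
    using explains_run[OF A e run] by blast
  have bij: "bij_betw f (nodes M) ({..<h} \<times> {..<w})"
    using f unfolding grid_coordinates_def by blast
  have inv: "inv_into (nodes M) f ij \<in> nodes M" "f (inv_into (nodes M) f ij) = ij"
    if "ij \<in> {..<h} \<times> {..<w}" for ij
    using bij that by (auto simp: bij_betw_def inv_into_into f_inv_into_f)
  show "p \<in> pictures (alphabet A)"
  proof -
    have "p $$ (i, j) \<in> alphabet A" if "i < h" "j < w" for i j
      using inv(1)[of "(i, j)"] pic that
      unfolding p_eq picture_graph_def pseudo_picture_graph_def by auto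
    then show ?thesis using hw unfolding pictures_def elements_mat_def by (auto simp: dim)
  qed
  define F where "F v = (int (fst (f v)), int (snd (f v)))" for v
  define \<sigma> where "\<sigma> q = \<kappa> (inv_into (nodes M) f (nat (fst q), nat (snd q)))" for q
  have F_rect: "F v \<in> rect h w" and \<sigma>F: "\<sigma> (F v) = \<kappa> v" if "v \<in> nodes M" for v
  proof -
    have "f v \<in> {..<h} \<times> {..<w}" using bij that unfolding bij_betw_def by blast
    then show "F v \<in> rect h w" unfolding F_def by (auto simp: mem_Times_iff)
    show "\<sigma> (F v) = \<kappa> v" using bij that unfolding \<sigma>_def F_def
      by (simp add: bij_betw_inv_into_left)
  qed
  have F_surj: "\<exists>v \<in> nodes M. q = F v" if "q \<in> rect h w" for q
    using that
  proof (rule rect_cases)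
    fix i j assume "q = (int i, int j)" "i < h" "j < w"
    then show ?thesis using inv[of "(i, j)"] unfolding F_def by (intro bexI) auto
  qed
  have F_inj: "v = v'" if "v \<in> nodes M" "v' \<in> nodes M" "F v = F v'" for v v'
  proof -
    have "f v = f v'" using that(3) unfolding F_def by (simp add: prod_eq_iff)
    then show ?thesis using bij that unfolding bij_betw_def inj_on_def by blast
  qed
  have F_edge: "(v, v') \<in> edges d M \<longleftrightarrow> F v' = F v + step d" if "v \<in> nodes M" "v' \<in> nodes M" for v v' d
  proof -
    have "(v, v') \<in> vedges M \<longleftrightarrow> (fst (f v) + 1, snd (f v)) = f v'"
      "(v, v') \<in> hedges M \<longleftrightarrow> (fst (f v), snd (f v) + 1) = f v'"
      using f that unfolding grid_coordinates_def by blast+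
    then show ?thesis
      by (cases d) (auto simp: edges_def F_def step_def prod_eq_iff)
  qed
  have nd: "cell_node (\<kappa> v) = g v" "label M v = label ?U (g v)"
    "snd (creator (\<kappa> v)) \<in> hyperedges A" "g v \<in> incidence A (snd (creator (\<kappa> v)))"
    "if fst (creator (\<kappa> v)) then snd (creator (\<kappa> v)) \<in> initial_hyperedges A
     else incoming A (snd (creator (\<kappa> v))) \<noteq> {} \<and> g v \<notin> incoming A (snd (creator (\<kappa> v)))"
    "consumer (\<kappa> v) = Some e' \<Longrightarrow>
           e' \<in> hyperedges A \<and> g v \<in> incoming A e' \<and> g v \<in> outgoing A (snd (creator (\<kappa> v)))"
    if "v \<in> nodes M" for v e'
    using ex that unfolding explains_def Let_def split_beta fst_conv snd_conv by blast+
  have act: "{v \<in> nodes M. g v \<in> outgoing A (snd (creator (\<kappa> v))) \<and> consumer (\<kappa> v) = None} = {}"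
    using ex unfolding explains_def by simp
  have ed: "(g (fst q), g (snd q)) \<in> edges d ?U \<and>
      (participates (\<kappa> (snd q)) (creator (\<kappa> (fst q))) \<or> participates (\<kappa> (fst q)) (creator (\<kappa> (snd q))))"
    if "q \<in> edges d M" for q d
    using ex that unfolding explains_def split_beta fst_conv snd_conv by blast
  have copy: "\<exists>k. is_copy A M \<kappa> \<epsilon> k \<and> k (g v) = v" if "v \<in> nodes M" "participates (\<kappa> v) \<epsilon>" for v \<epsilon>
    using ex that unfolding explains_def prod.case by blast
  have root: "creator (\<kappa> v) = creator (\<kappa> v') \<and> (g v = g v' \<longrightarrow> v = v')"
    if "v \<in> nodes M" "v' \<in> nodes M" "fst (creator (\<kappa> v))" "fst (creator (\<kappa> v'))" for v v'
    using ex that unfolding explains_def by simp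
  \<comment> \<open>A copy inside the picture supplies the embedding itself: follow \<open>k\<close>
    by the coordinates \<open>F\<close>.\<close>
  have emb: "Ex (grid_embedding (hyperedge_graph A (snd \<epsilon>)))" if v: "v \<in> nodes M" "participates (\<kappa> v) \<epsilon>" for v \<epsilon>
  proof -
    obtain k where k: "is_copy A M \<kappa> \<epsilon> k" using copy[OF v] by blast
    have kn: "k y \<in> nodes M" "cell_node (\<kappa> (k y)) = y" if "y \<in> incidence A (snd \<epsilon>)" for y
      using k that unfolding is_copy_def by blast+
    have "grid_embedding (hyperedge_graph A (snd \<epsilon>)) (F \<circ> k)"
      unfolding grid_embedding_def nodes_hyperedge_graph
    proof (intro conjI allI ballI)
      show "inj_on (F \<circ> k) (incidence A (snd \<epsilon>))"
      proof (rule inj_onI)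
        fix x y assume xy: "x \<in> incidence A (snd \<epsilon>)" "y \<in> incidence A (snd \<epsilon>)" "(F \<circ> k) x = (F \<circ> k) y"
        then have "k x = k y" using F_inj[of "k x" "k y"] kn(1) by simp
        then show "x = y" using kn(2) xy by metis
      qed
    next
      fix d x y assume xy: "x \<in> incidence A (snd \<epsilon>)" "y \<in> incidence A (snd \<epsilon>)"
      then have "(x, y) \<in> edges d ?U \<longleftrightarrow> (k x, k y) \<in> edges d M"
        using k unfolding is_copy_def by blast
      then show "((x, y) \<in> edges d (hyperedge_graph A (snd \<epsilon>))) = ((F \<circ> k) y = (F \<circ> k) x + step d)"
        using F_edge[OF kn(1)[OF xy(1)] kn(1)[OF xy(2)]] xy by (simp add: edges_hyperedge_graph)
    qed
    then show ?thesis by blast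
  qed
  \<comment> \<open>Since the whole copy is present, an edge of its graph at \<open>g v\<close> is
    realised by an edge at \<open>v\<close> leading to a node of the same copy.\<close>
  have near: "\<exists>v' \<in> nodes M. (v, v') \<in> edges d M \<and> g v' = y \<and> participates (\<kappa> v') \<epsilon>"
    if v: "v \<in> nodes M" "participates (\<kappa> v) \<epsilon>" and y: "(g v, y) \<in> edges d (hyperedge_graph A (snd \<epsilon>))" for v y d \<epsilon>
  proof -
    obtain k where k: "is_copy A M \<kappa> \<epsilon> k" "k (g v) = v" using copy[OF v] by blast
    have "g v \<in> incidence A (snd \<epsilon>)" "y \<in> incidence A (snd \<epsilon>)" "(g v, y) \<in> edges d ?U"
      using y by (auto simp: edges_hyperedge_graph)
    then show ?thesis using k nd(1) unfolding is_copy_def by metis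
  qed
  have near': "\<exists>v' \<in> nodes M. (v', v) \<in> edges d M \<and> g v' = y \<and> participates (\<kappa> v') \<epsilon>"
    if v: "v \<in> nodes M" "participates (\<kappa> v) \<epsilon>" and y: "(y, g v) \<in> edges d (hyperedge_graph A (snd \<epsilon>))" for v y d \<epsilon>
  proof -
    obtain k where k: "is_copy A M \<kappa> \<epsilon> k" "k (g v) = v" using copy[OF v] by blast
    have "g v \<in> incidence A (snd \<epsilon>)" "y \<in> incidence A (snd \<epsilon>)" "(y, g v) \<in> edges d ?U"
      using y by (auto simp: edges_hyperedge_graph)
    then show ?thesis using k nd(1) unfolding is_copy_def by metis
  qed
  have part_creator: "participates a (creator a)" for a :: "('a, 'b) cell"
    by (simp add: participates_def)
  have part_consumer: "consumer a = Some e' \<Longrightarrow> participates a (False, e')" for a :: "('a, 'b) cell" and e'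
    by (simp add: participates_def)
  have "tiling A h w \<sigma>"
    unfolding tiling_def
  proof (intro conjI ballI allI impI)
    fix q d assume q_in: "q \<in> rect h w"
    then obtain v where v: "v \<in> nodes M" and q: "q = F v" using F_surj by blast
    have "valid_cell A (\<kappa> v)"
      unfolding valid_cell_def Let_def
    proof (intro conjI allI impI)
      \<comment> \<open>The final set of active nodes is empty, so each outgoing node has found a
        consumer.\<close>
      show "(consumer (\<kappa> v) = None) = (cell_node (\<kappa> v) \<notin> outgoing A (snd (creator (\<kappa> v))))"
        using nd(1,6)[OF v] act v by (cases "consumer (\<kappa> v)") auto
      show "Ex (grid_embedding (hyperedge_graph A (snd (creator (\<kappa> v)))))"
        using emb[OF v part_creator] .
      show "Ex (grid_embedding (hyperedge_graph A e'))" if "consumer (\<kappa> v) = Some e'" for e'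
        using emb[OF v part_consumer[OF that]] by simp
    qed (use nd[OF v] in auto)
    then show "valid_cell A (\<sigma> q)" using \<sigma>F[OF v] q by simp
    show "if q + step d \<in> rect h w then compatible A d (\<sigma> q) (\<sigma> (q + step d))
        else final_cell A d (\<sigma> q)"
    proof (cases "q + step d \<in> rect h w")
      case True
      then obtain v' where v': "v' \<in> nodes M" and q': "q + step d = F v'" using F_surj by blast
      then have vv': "(v, v') \<in> edges d M" using F_edge[OF v v'] q by simp
      have "compatible A d (\<kappa> v) (\<kappa> v')"
        unfolding compatible_def
      proof (intro conjI allI impI)
        show "(cell_node (\<kappa> v), cell_node (\<kappa> v')) \<in> edges d ?U"
          "participates (\<kappa> v') (creator (\<kappa> v)) \<or> participates (\<kappa> v) (creator (\<kappa> v'))"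
          using ed[OF vv'] nd(1) v v' by simp_all
      next
        fix \<epsilon> y
        assume a: "participates (\<kappa> v) \<epsilon> \<and> (cell_node (\<kappa> v), y) \<in> edges d (hyperedge_graph A (snd \<epsilon>))"
        then obtain u where u: "u \<in> nodes M" "(v, u) \<in> edges d M" "g u = y" "participates (\<kappa> u) \<epsilon>"
          using near[OF v] nd(1)[OF v] by metis
        \<comment> \<open>The position one step from \<open>v\<close> is occupied by a single
          node.\<close>
        then have "u = v'" using F_edge[OF v u(1)] F_edge[OF v v'] F_inj[OF u(1) v'] vv' by simp
        then show "cell_node (\<kappa> v') = y" "participates (\<kappa> v') \<epsilon>" using u nd(1) by auto
      next
        fix \<epsilon> y
        assume a: "participates (\<kappa> v') \<epsilon> \<and> (y, cell_node (\<kappa> v')) \<in> edges d (hyperedge_graph A (snd \<epsilon>))"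
        then obtain u where u: "u \<in> nodes M" "(u, v') \<in> edges d M" "g u = y" "participates (\<kappa> u) \<epsilon>"
          using near'[OF v'] nd(1)[OF v'] by metis
        then have "u = v" using F_edge[OF u(1) v'] F_edge[OF v v'] F_inj[OF u(1) v] vv' by simp
        then show "cell_node (\<kappa> v) = y" "participates (\<kappa> v) \<epsilon>" using u nd(1) by auto
      qed
      then show ?thesis using True \<sigma>F[OF v] \<sigma>F[OF v'] q' q by simp
    next
      case False
      have "final_cell A d (\<kappa> v)"
        unfolding final_cell_def
      proof (intro allI impI notI)
        fix \<epsilon> y assume a: "participates (\<kappa> v) \<epsilon>" "(cell_node (\<kappa> v), y) \<in> edges d (hyperedge_graph A (snd \<epsilon>))"
        then obtain u where u: "u \<in> nodes M" "(v, u) \<in> edges d M"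
          using near[OF v] nd(1)[OF v] by metis
        then show False using F_edge[OF v u(1)] F_rect[OF u(1)] False q by simp
      qed
      then show ?thesis using False \<sigma>F[OF v] q by simp
    qed
    show "first_cell A d (\<sigma> q)" if out: "q - step d \<notin> rect h w"
    proof -
      have "first_cell A d (\<kappa> v)"
        unfolding first_cell_def
      proof (intro allI impI notI)
        fix \<epsilon> y assume a: "participates (\<kappa> v) \<epsilon>" "(y, cell_node (\<kappa> v)) \<in> edges d (hyperedge_graph A (snd \<epsilon>))"
        then obtain u where u: "u \<in> nodes M" "(u, v) \<in> edges d M"
          using near'[OF v] nd(1)[OF v] by metis
        then have "q - step d = F u" using F_edge[OF u(1) v] q by simp
        then show False using F_rect[OF u(1)] out by simp
      qed
      then show ?thesis using \<sigma>F[OF v] q by simp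
    qed
  next
    fix q q' assume q_in: "q \<in> rect h w" "q' \<in> rect h w" and mk: "marked A (\<sigma> q) \<and> marked A (\<sigma> q')"
    obtain v v' where v: "v \<in> nodes M" "v' \<in> nodes M" and q: "q = F v" "q' = F v'"
      using F_surj q_in by blast
    have "marked A (\<kappa> v)" "marked A (\<kappa> v')" using mk \<sigma>F v q by simp_all
    then show "q = q'"
      using root[OF v] nd(1)[OF v(1)] nd(1)[OF v(2)] q unfolding marked_def by metis
  qed
  moreover have "label ?U (cell_node (\<sigma> (int i, int j))) = p $$ (i, j)" if "i < h" "j < w" for i j
    using inv[of "(i, j)"] that nd(1,2) by (simp add: \<sigma>_def p_eq)
  ultimately show "\<exists>\<sigma>. tiling A (dim_row p) (dim_col p) \<sigma> \<and> (\<forall>i<dim_row p. \<forall>j<dim_col p.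
      label ?U (cell_node (\<sigma> (int i, int j))) = p $$ (i, j))"
    unfolding dim by blast
qed


section \<open>From tilings to derivations\<close>

fun displacement :: "move list \<Rightarrow> int \<times> int" where
  "displacement [] = 0"
| "displacement (m # ms) = (case m of MDown \<Rightarrow> (1, 0) | MUp \<Rightarrow> (-1, 0) | MRight \<Rightarrow> (0, 1) | MLeft \<Rightarrow> (0, -1))
     + displacement ms"

lemma displacement_append: "displacement (ms @ ms') = displacement ms + displacement ms'"
  by (induction ms) (simp_all add: add.assoc)

lemma displacement_concat:
  "displacement (concat (map seg [0..<n])) = (\<Sum>i<n. displacement (seg i))"
  by (induction n) (simp_all add: displacement_append)

lemma displacement_count: "displacement ms =
    (int (count_list ms MDown) - int (count_list ms MUp), int (count_list ms MRight) - int (count_list ms MLeft))"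
  by (induction ms) (auto simp: zero_prod_def split: move.split)

lemma balanced_iff: "balanced ms \<longleftrightarrow> displacement ms = 0"
  by (auto simp: balanced_def displacement_count zero_prod_def)

text \<open>Each move shifts the coordinates by its unit vector, so in an embedded graph the
  displacement depends on the end points alone. Any walk between them may then be chosen for a
  loop.\<close>

lemma walk_displacement:
  assumes "grid_embedding G c" and edges: "\<And>d. edges d G \<subseteq> nodes G \<times> nodes G"
    and "walk G x ms y"
  shows "c y = c x + displacement ms"
  using assms(3)
proof (induction ms arbitrary: x)
  case (Cons m ms)
  then obtain z where z: "move_edge G m x z" "walk G z ms y" by auto
  have e: "c v = c u + step d" if "(u, v) \<in> edges d G" for u v d
    using assms(1) that edges[of d] unfolding grid_embedding_def by blast
  have "c z = c x + displacement [m]"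
  proof (cases m)
    case MDown
    then show ?thesis using e[of x z True] z by (simp add: edges_def step_def)
  next
    case MUp
    then show ?thesis using e[of z x True] z by (simp add: edges_def step_def prod_eq_iff)
  next
    case MRight
    then show ?thesis using e[of x z False] z by (simp add: edges_def step_def)
  next
    case MLeft
    then show ?thesis using e[of z x False] z by (simp add: edges_def step_def prod_eq_iff)
  qed
  then show ?case using Cons.IH[OF z(2)] by (simp add: add.assoc)
qed simp

section \<open>Undirected connectivity, walks and gluing\<close>

definition link :: "('v, 's) pgraph \<Rightarrow> ('v \<times> 'v) set" where
  "link G = (\<Union>d. edges d G \<union> (edges d G)\<inverse>)"

lemma connected_graph_link:
  "connected_graph G \<longleftrightarrow> (\<forall>x \<in> nodes G. \<forall>y \<in> nodes G. (x, y) \<in> (link G)\<^sup>*)"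
proof -
  have "link G = vedges G \<union> hedges G \<union> (vedges G \<union> hedges G)\<inverse>"
    by (auto simp: link_def edges_def UNIV_bool)
  then show ?thesis by (simp add: connected_graph_def Let_def)
qed

lemma sym_link: "sym (link G)"
  by (auto simp: link_def sym_def)

lemma link_cases:
  assumes "(x, y) \<in> link G"
  obtains d where "(x, y) \<in> edges d G" | d where "(y, x) \<in> edges d G"
  using assms by (auto simp: link_def)

lemma link_walk:
  assumes "(x, y) \<in> (link G)\<^sup>*" "y \<in> nodes G"
  shows "\<exists>ms. walk G x ms y"
  using assms(1)
proof (induction rule: converse_rtrancl_induct)
  case base
  then show ?case using assms(2) by (intro exI[of _ "[]"]) simp
next
  case (step x z)
  obtain ms where ms: "walk G z ms y" using step by blast
  obtain m where "move_edge G m x z"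
  proof -
    have "move_edge G MDown x z \<or> move_edge G MRight x z \<or> move_edge G MUp x z \<or> move_edge G MLeft x z"
      using step(1) by (auto simp: link_def edges_def split: if_splits)
    then show ?thesis using that by blast
  qed
  with ms show ?case by (intro exI[of _ "m # ms"]) auto
qed

lemma link_map:
  assumes "\<And>u v d. (u, v) \<in> edges d G \<Longrightarrow> (k u, k v) \<in> edges d M" and "(x, y) \<in> (link G)\<^sup>*"
  shows "(k x, k y) \<in> (link M)\<^sup>*"
  using assms(2)
proof (induction rule: rtrancl_induct)
  case (step y z)
  have "(k y, k z) \<in> link M" using step(2) assms(1) unfolding link_def by blast
  then show ?case using step.IH by simp
qed simp

lemma connected_graph_image:
  assumes "connected_graph G" "nodes M = k ` nodes G"
    and "\<And>u v d. (u, v) \<in> edges d G \<Longrightarrow> (k u, k v) \<in> edges d M"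
  shows "connected_graph M"
  unfolding connected_graph_link
proof (intro ballI)
  fix u v assume "u \<in> nodes M" "v \<in> nodes M"
  then obtain x y where xy: "x \<in> nodes G" "y \<in> nodes G" "u = k x" "v = k y"
    unfolding assms(2) by blast
  then have "(x, y) \<in> (link G)\<^sup>*" using assms(1) unfolding connected_graph_link by blast
  then show "(u, v) \<in> (link M)\<^sup>*" using link_map[of G k M, OF assms(3)] xy(3,4) by simp
qed

text \<open>The node \<open>k y0\<close> lies in both parts and serves as a hub that every node
  reaches.\<close>

lemma connected_graph_glue:
  assumes "connected_graph G1" "connected_graph G2" "nodes M = nodes G1 \<union> k ` nodes G2"
    and "\<And>d. edges d G1 \<subseteq> edges d M"
    and "\<And>u v d. (u, v) \<in> edges d G2 \<Longrightarrow> (k u, k v) \<in> edges d M"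
    and y0: "y0 \<in> nodes G2" "k y0 \<in> nodes G1"
  shows "connected_graph M"
proof -
  have "(v, k y0) \<in> (link M)\<^sup>*" if "v \<in> nodes M" for v
  proof (cases "v \<in> nodes G1")
    case True
    then have "(v, k y0) \<in> (link G1)\<^sup>*" using assms(1) y0 unfolding connected_graph_link by blast
    then show ?thesis using link_map[of G1 id M v "k y0"] assms(4) by auto
  next
    case False
    then obtain y where y: "y \<in> nodes G2" "v = k y" using \<open>v \<in> nodes M\<close> assms(3) by blast
    then have "(y, y0) \<in> (link G2)\<^sup>*" using assms(2) y0 unfolding connected_graph_link by blast
    then show ?thesis using link_map[of G2 k M, OF assms(5)] y by blast
  qed
  moreover have "sym ((link M)\<^sup>*)" by (rule sym_rtrancl[OF sym_link])
  ultimately show ?thesis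
    unfolding connected_graph_link by (meson rtrancl_trans symD)
qed

text \<open>
  An occurrence consists of the kind of copy and the position of the origin of its coordinates.
\<close>

type_synonym 'e occurrence = "(bool \<times> 'e) \<times> int \<times> int"

section \<open>Occurrences of hyperedges in a tiled picture\<close>

locale tiled_picture =
  fixes A :: "('n, 'e, 's) sa_automaton" and h w :: nat and \<sigma> :: "int \<times> int \<Rightarrow> ('n, 'e) cell"
  assumes A: "sa_hypergraph_automaton A"
    and pos_h: "0 < h" and pos_w: "0 < w"
    and tiling: "tiling A h w \<sigma>"
begin

abbreviation D :: "(int \<times> int) set" where "D \<equiv> rect h w"
abbreviation node :: "int \<times> int \<Rightarrow> 'n" where "node q \<equiv> cell_node (\<sigma> q)"
abbreviation hyp :: "'e occurrence \<Rightarrow> 'e" where "hyp t \<equiv> snd (fst t)"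

text \<open>One embedding is fixed per hyperedge, so that origins computed from different cells can
  be compared. It exists for every hyperedge named in a valid cell.\<close>

definition coord :: "'e \<Rightarrow> 'n \<Rightarrow> int \<times> int" where
  "coord e = (SOME c. grid_embedding (hyperedge_graph A e) c)"

text \<open>The origin is the point with coordinate zero. It need not be a cell of the picture,
  since the embedding is an arbitrary one.\<close>

definition occ :: "bool \<times> 'e \<Rightarrow> int \<times> int \<Rightarrow> 'e occurrence" where
  "occ \<epsilon> q = (\<epsilon>, q - coord (snd \<epsilon>) (node q))"

definition born :: "int \<times> int \<Rightarrow> 'e occurrence" where
  "born q = occ (creator (\<sigma> q)) q"

definition used :: "int \<times> int \<Rightarrow> 'e occurrence option" where
  "used q = map_option (\<lambda>e. occ (False, e) q) (consumer (\<sigma> q))"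

definition inocc :: "int \<times> int \<Rightarrow> 'e occurrence \<Rightarrow> bool" where
  "inocc q t \<longleftrightarrow> born q = t \<or> used q = Some t"

definition Occ :: "'e occurrence set" where
  "Occ = {t. \<exists>q \<in> D. inocc q t}"

definition place :: "'e occurrence \<Rightarrow> 'n \<Rightarrow> int \<times> int" where
  "place t y = snd t + coord (hyp t) y"

text \<open>The order in time that any derivation producing this tiling has to respect.\<close>

definition pred :: "('e occurrence \<times> 'e occurrence) set" where
  "pred = {(s, t). \<exists>q \<in> D. born q = s \<and> used q = Some t}"

lemma finite_D: "finite D"
  by (simp add: rect_def)

lemma valid: "q \<in> D \<Longrightarrow> valid_cell A (\<sigma> q)"
  using tiling unfolding tiling_def by blast

lemma fst_born [simp]: "fst (born q) = creator (\<sigma> q)"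
  by (simp add: born_def occ_def)

lemma used_SomeD: "used q = Some t \<Longrightarrow> \<not> fst (fst t) \<and> consumer (\<sigma> q) = Some (hyp t) \<and> t = occ (False, hyp t) q"
  by (auto simp: used_def occ_def)

lemma inocc_participates: "inocc q t \<longleftrightarrow> participates (\<sigma> q) (fst t) \<and> t = occ (fst t) q"
  by (cases t; cases "fst t") (auto simp: inocc_def participates_def born_def used_def occ_def)

lemma born_facts:
  assumes "q \<in> D"
  shows "hyp (born q) \<in> hyperedges A" "node q \<in> incidence A (hyp (born q))"
    "fst (fst (born q)) \<Longrightarrow> hyp (born q) \<in> initial_hyperedges A"
    "\<not> fst (fst (born q)) \<Longrightarrow> incoming A (hyp (born q)) \<noteq> {}"
    "\<not> fst (fst (born q)) \<Longrightarrow> node q \<notin> incoming A (hyp (born q))"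
    "used q = None \<longleftrightarrow> node q \<notin> outgoing A (hyp (born q))"
    "Ex (grid_embedding (hyperedge_graph A (hyp (born q))))"
  using valid[OF assms] unfolding valid_cell_def Let_def by (auto simp: used_def split: if_splits)

lemma used_facts:
  assumes "q \<in> D" "used q = Some t"
  shows "hyp t \<in> hyperedges A" "\<not> fst (fst t)" "node q \<in> incoming A (hyp t)"
    "Ex (grid_embedding (hyperedge_graph A (hyp t)))"
  using valid[OF assms(1)] used_SomeD[OF assms(2)] unfolding valid_cell_def Let_def by auto

lemma inocc_facts:
  assumes "q \<in> D" "inocc q t"
  shows "hyp t \<in> hyperedges A" "node q \<in> incidence A (hyp t)" "q = place t (node q)"
    "grid_embedding (hyperedge_graph A (hyp t)) (coord (hyp t))"
proof -
  have *: "hyp t \<in> hyperedges A \<and> node q \<in> incidence A (hyp t) \<and> Ex (grid_embedding (hyperedge_graph A (hyp t)))"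
    using assms(2) unfolding inocc_def
  proof
    assume "born q = t"
    then show ?thesis using born_facts(1,2,7)[OF assms(1)] by blast
  next
    assume "used q = Some t"
    then show ?thesis using used_facts[OF assms(1)] automaton_hyperedge(2)[OF A] by blast
  qed
  then show "hyp t \<in> hyperedges A" "node q \<in> incidence A (hyp t)" by blast+
  show "grid_embedding (hyperedge_graph A (hyp t)) (coord (hyp t))"
    using * unfolding coord_def by (simp add: someI_ex)
  have "t = occ (fst t) q" using assms(2) inocc_participates by blast
  then have "snd t = q - coord (hyp t) (node q)" unfolding occ_def by (metis snd_conv)
  then show "q = place t (node q)" unfolding place_def by simp
qed

text \<open>The node alone tells the role of a cell in an occurrence: an ordinary copy consumes
  precisely its incoming nodes, and a root occurrence consumes nothing.\<close>

lemma born_used_iff: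
  assumes "q \<in> D" "inocc q t"
  shows "born q = t \<longleftrightarrow> fst (fst t) \<or> node q \<notin> incoming A (hyp t)"
    and "used q = Some t \<longleftrightarrow> \<not> fst (fst t) \<and> node q \<in> incoming A (hyp t)"
  using assms(2) born_facts(5)[OF assms(1)] used_facts[OF assms(1)] unfolding inocc_def by blast+

lemma Occ_facts:
  assumes "t \<in> Occ"
  shows "hyp t \<in> hyperedges A" "grid_embedding (hyperedge_graph A (hyp t)) (coord (hyp t))"
    "incidence A (hyp t) \<noteq> {}"
  using assms inocc_facts unfolding Occ_def by blast+

text \<open>Positions and coordinates change by the same vector, so both cells compute the same
  origin.\<close>

lemma inocc_occI:
  assumes "participates (\<sigma> q') (fst t)" "inocc q t" "q' = q + (coord (hyp t) (node q') - coord (hyp t) (node q))"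
  shows "inocc q' t"
proof -
  have "t = occ (fst t) q" using assms(2) inocc_participates by blast
  also have "\<dots> = occ (fst t) q'" using assms(3) unfolding occ_def by (simp add: algebra_simps)
  finally show ?thesis using assms(1) inocc_participates by blast
qed

text \<open>\<open>final_cell\<close> excludes the border, \<open>compatible\<close> carries the
  copy to the neighbour, and the embedding shifts the coordinate by the same step, which preserves
  the origin.\<close>

lemma inocc_step:
  assumes q: "q \<in> D" "inocc q t" and e: "(node q, y) \<in> edges d (hyperedge_graph A (hyp t))"
  shows "q + step d \<in> D \<and> node (q + step d) = y \<and> inocc (q + step d) t"
proof -
  have part: "participates (\<sigma> q) (fst t)" using q(2) inocc_participates by blast
  have "q + step d \<in> D"
    using tiling q(1) part e unfolding tiling_def final_cell_def by meson
  moreover from this have "compatible A d (\<sigma> q) (\<sigma> (q + step d))"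
    using tiling q(1) unfolding tiling_def by meson
  then have n: "node (q + step d) = y" "participates (\<sigma> (q + step d)) (fst t)"
    using part e unfolding compatible_def by blast+
  moreover have "coord (hyp t) y = coord (hyp t) (node q) + step d"
    using inocc_facts(4)[OF q] e unfolding grid_embedding_def by (auto simp: edges_hyperedge_graph)
  then have "inocc (q + step d) t"
    by (intro inocc_occI[OF n(2) q(2)]) (simp add: n(1))
  ultimately show ?thesis by blast
qed

lemma inocc_step_back:
  assumes q: "q \<in> D" "inocc q t" and e: "(y, node q) \<in> edges d (hyperedge_graph A (hyp t))"
  shows "q - step d \<in> D \<and> node (q - step d) = y \<and> inocc (q - step d) t"
proof -
  have part: "participates (\<sigma> q) (fst t)" using q(2) inocc_participates by blast
  have D: "q - step d \<in> D"
    using tiling q(1) part e unfolding tiling_def first_cell_def by meson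
  have "q - step d + step d \<in> D" using q(1) by simp
  then have "compatible A d (\<sigma> (q - step d)) (\<sigma> (q - step d + step d))"
    using tiling D unfolding tiling_def by meson
  then have "compatible A d (\<sigma> (q - step d)) (\<sigma> q)" by simp
  then have n: "node (q - step d) = y" "participates (\<sigma> (q - step d)) (fst t)"
    using part e unfolding compatible_def by blast+
  have "coord (hyp t) (node q) = coord (hyp t) y + step d"
    using inocc_facts(4)[OF q] e unfolding grid_embedding_def by (auto simp: edges_hyperedge_graph)
  then have "inocc (q - step d) t"
    by (intro inocc_occI[OF n(2) q(2)]) (simp add: n(1))
  with D n show ?thesis by blast
qed

text \<open>Here local conditions become global: starting from one cell of the occurrence, steps
  along edges reach every node, because the hyperedge graph is connected. The origin fixes where
  each node is found.\<close>

lemma place_in: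
  assumes t: "t \<in> Occ" and y: "y \<in> incidence A (hyp t)"
  shows "place t y \<in> D" "node (place t y) = y" "inocc (place t y) t"
proof -
  obtain q where q: "q \<in> D" "inocc q t" using t unfolding Occ_def by blast
  note iq = inocc_facts[OF q]
  have "connected_graph (hyperedge_graph A (hyp t))"
    using A iq(1) unfolding sa_hypergraph_automaton_def by blast
  then have "(node q, y) \<in> (link (hyperedge_graph A (hyp t)))\<^sup>*"
    using iq(2) y unfolding connected_graph_link by simp
  then have "\<exists>q'. q' \<in> D \<and> node q' = y \<and> inocc q' t"
  proof (induction rule: rtrancl_induct)
    case base
    then show ?case using q by blast
  next
    case (step y z)
    then obtain q' where q': "q' \<in> D" "node q' = y" "inocc q' t" by blast
    from step(2) show ?case
      using inocc_step[OF q'(1,3)] inocc_step_back[OF q'(1,3)] q'(2)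
      by (elim link_cases) blast+
  qed
  then obtain q' where q': "q' \<in> D" "node q' = y" "inocc q' t" by blast
  moreover have "q' = place t y" using inocc_facts(3)[OF q'(1,3)] q'(2) by simp
  ultimately show "place t y \<in> D" "node (place t y) = y" "inocc (place t y) t" by simp_all
qed

lemma place_edge:
  assumes "t \<in> Occ" "y \<in> incidence A (hyp t)" "z \<in> incidence A (hyp t)"
  shows "place t z = place t y + step d \<longleftrightarrow> (y, z) \<in> edges d (underlying A)"
  using Occ_facts(2)[OF assms(1)] assms(2,3)
  unfolding grid_embedding_def place_def by (simp add: edges_hyperedge_graph add.assoc)

lemma born_Occ: "q \<in> D \<Longrightarrow> born q \<in> Occ"
  unfolding Occ_def inocc_def by blast

lemma used_Occ: "q \<in> D \<Longrightarrow> used q = Some t \<Longrightarrow> t \<in> Occ"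
  unfolding Occ_def inocc_def by blast

lemma finite_Occ: "finite Occ"
proof (rule finite_subset)
  show "Occ \<subseteq> born ` D \<union> (\<lambda>q. the (used q)) ` D"
    unfolding Occ_def inocc_def by force
qed (simp add: finite_D)

text \<open>Each root occurrence creates the cell of its representative node, and this cell is
  marked. As only one cell is marked and a cell has one creator, the occurrences agree.\<close>

lemma root_unique:
  assumes "s \<in> Occ" "t \<in> Occ" "fst (fst s)" "fst (fst t)"
  shows "s = t"
proof -
  define m where "m t = place t (SOME x. x \<in> incidence A (hyp t))" for t
  have m: "m t \<in> D \<and> marked A (\<sigma> (m t)) \<and> born (m t) = t" if t: "t \<in> Occ" "fst (fst t)" for t
  proof -
    have "(SOME x. x \<in> incidence A (hyp t)) \<in> incidence A (hyp t)"
      using Occ_facts(3)[OF t(1)] by (simp add: some_in_eq)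
    note p = place_in[OF t(1) this, folded m_def]
    have b: "born (m t) = t" using born_used_iff(1)[OF p(1,3)] t(2) by blast
    then have "creator (\<sigma> (m t)) = fst t" using fst_born by metis
    then show ?thesis using p b t(2) unfolding marked_def by simp
  qed
  have "m s = m t" using m[OF assms(1,3)] m[OF assms(2,4)] tiling unfolding tiling_def by blast
  then show ?thesis using m[OF assms(1,3)] m[OF assms(2,4)] by metis
qed

text \<open>The cells share a copy by \<open>compatible\<close>. Their nodes are joined in the
  underlying graph, hence in the induced hyperedge graph, so the embedding separates them by the
  same step as the picture does: it is one and the same occurrence.\<close>

lemma adjacent_inocc:
  assumes "a \<in> D" "b \<in> D" "b = a + step d"
  shows "(node a, node b) \<in> edges d (underlying A)" "inocc b (born a) \<or> inocc a (born b)"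
proof -
  have c: "compatible A d (\<sigma> a) (\<sigma> b)"
    using tiling assms unfolding tiling_def by meson
  then show e: "(node a, node b) \<in> edges d (underlying A)" unfolding compatible_def by blast
  have in_inc: "node q \<in> incidence A (snd \<epsilon>)" if "q \<in> D" "participates (\<sigma> q) \<epsilon>" for q \<epsilon>
  proof -
    have "inocc q (occ \<epsilon> q)" using that(2) unfolding inocc_participates by (simp add: occ_def)
    then show ?thesis using inocc_facts(2)[OF that(1)] by (metis fst_conv occ_def)
  qed
  have inocc_born: "inocc q (born q)" for q by (simp add: inocc_def)
  have cd: "coord (hyp t) (node b) = coord (hyp t) (node a) + step d"
    if "t \<in> Occ" "node a \<in> incidence A (hyp t)" "node b \<in> incidence A (hyp t)" for t
    using Occ_facts(2)[OF that(1)] that(2,3) e unfolding grid_embedding_def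
    by (simp add: edges_hyperedge_graph)
  from c have "participates (\<sigma> b) (creator (\<sigma> a)) \<or> participates (\<sigma> a) (creator (\<sigma> b))"
    unfolding compatible_def by blast
  then show "inocc b (born a) \<or> inocc a (born b)"
  proof
    assume p: "participates (\<sigma> b) (creator (\<sigma> a))"
    have "coord (hyp (born a)) (node b) = coord (hyp (born a)) (node a) + step d"
      using cd[OF born_Occ[OF assms(1)]] in_inc[OF assms(2) p] born_facts(2)[OF assms(1)] by simp
    then have "inocc b (born a)"
      using p inocc_born assms(3) by (intro inocc_occI[of b "born a" a]) simp_all
    then show ?thesis ..
  next
    assume p: "participates (\<sigma> a) (creator (\<sigma> b))"
    have "coord (hyp (born b)) (node b) = coord (hyp (born b)) (node a) + step d"
      using cd[OF born_Occ[OF assms(2)]] in_inc[OF assms(1) p] born_facts(2)[OF assms(2)] by simp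
    then have "inocc a (born b)"
      using p inocc_born assms(3) by (intro inocc_occI[of a "born b" b]) simp_all
    then show ?thesis ..
  qed
qed

text \<open>
  A cycle of occurrences, each creating a cell that the next one consumes, is traversed by a
  closed walk in the picture, whose net displacement is zero.
\<close>

lemma acyclic_pred:
  assumes "\<nexists>es. strong_loop A es"
  shows "acyclic pred"
proof (rule ccontr)
  assume "\<not> acyclic pred"
  then obtain t where "(t, t) \<in> pred\<^sup>+" unfolding acyclic_def by blast
  then obtain n where "0 < n" "(t, t) \<in> pred ^^ n" by (auto simp: trancl_power)
  then obtain f where f: "f 0 = t" "f n = t" "\<And>i. i < n \<Longrightarrow> (f i, f (Suc i)) \<in> pred"
    unfolding relpow_fun_conv by blast
  obtain q where q: "\<And>i. i < n \<Longrightarrow> q i \<in> D \<and> born (q i) = f i \<and> used (q i) = Some (f (Suc i))"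
  proof -
    have "\<forall>i. \<exists>q. i < n \<longrightarrow> q \<in> D \<and> born q = f i \<and> used q = Some (f (Suc i))"
      using f(3) unfolding pred_def by blast
    then show ?thesis using that by metis
  qed
  define es where "es = map (\<lambda>i. hyp (f i)) [0..<Suc n]"
  have len: "length es = Suc n" by (simp add: es_def)
  have es_nth: "es ! i = hyp (f i)" if "i \<le> n" for i
    unfolding es_def using that by (subst nth_map) (simp_all del: upt_Suc)
  \<comment> \<open>Segment \<open>i\<close> starts at the cell \<open>Z i\<close>, which
    \<open>f (i - 1)\<close> hands to \<open>f i\<close>. The closed walk begins at
    \<open>q (n - 1)\<close>, consumed by \<open>f n = f 0\<close> and so lying in the first and in
    the last occurrence; the last segment leads from this cell to itself.\<close>
  define Z where "Z i = (if i = 0 \<or> i = Suc n then q (n - 1) else q (i - 1))" for i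
  have Z_D: "Z i \<in> D" if "i \<le> Suc n" for i
    using that \<open>0 < n\<close> q unfolding Z_def by auto
  have Z_in: "inocc (Z i) (f i) \<and> inocc (Z (Suc i)) (f i)" if "i \<le> n" for i
  proof
    show "inocc (Z i) (f i)"
    proof (cases "i = 0")
      case True
      then show ?thesis using q[of "n - 1"] \<open>0 < n\<close> f(1,2) unfolding Z_def inocc_def by simp
    next
      case False
      then show ?thesis using q[of "i - 1"] that unfolding Z_def inocc_def by simp
    qed
    show "inocc (Z (Suc i)) (f i)"
    proof (cases "i = n")
      case True
      then show ?thesis using q[of "n - 1"] \<open>0 < n\<close> unfolding Z_def inocc_def by simp
    next
      case False
      then show ?thesis using q[of i] that unfolding Z_def inocc_def by simp
    qed
  qed
  have "\<exists>ms. walk (hyperedge_graph A (es ! i)) (node (Z i)) ms (node (Z (Suc i))) \<and>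
      displacement ms = Z (Suc i) - Z i" if "i \<le> n" for i
  proof -
    let ?G = "hyperedge_graph A (hyp (f i))"
    note a = inocc_facts[OF Z_D conjunct1[OF Z_in[OF that]]]
      and b = inocc_facts[OF Z_D conjunct2[OF Z_in[OF that]]]
    have D: "i \<le> Suc n" "Suc i \<le> Suc n" using that by auto
    have "connected_graph ?G" using A a(1)[OF D(1)] unfolding sa_hypergraph_automaton_def by blast
    then have "(node (Z i), node (Z (Suc i))) \<in> (link ?G)\<^sup>*"
      using a(2)[OF D(1)] b(2)[OF D(2)] unfolding connected_graph_link by simp
    then obtain ms where ms: "walk ?G (node (Z i)) ms (node (Z (Suc i)))"
      using link_walk b(2)[OF D(2)] by (metis nodes_hyperedge_graph)
    \<comment> \<open>Coordinates and positions differ by the fixed origin of the occurrence, so a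
      walk in the hyperedge graph is displaced exactly as the cells are.\<close>
    have "coord (hyp (f i)) (node (Z (Suc i))) = coord (hyp (f i)) (node (Z i)) + displacement ms"
      by (rule walk_displacement[OF a(4)[OF D(1)] _ ms]) (auto simp: edges_hyperedge_graph)
    then have "displacement ms = place (f i) (node (Z (Suc i))) - place (f i) (node (Z i))"
      unfolding place_def by simp
    also have "\<dots> = Z (Suc i) - Z i" using a(3)[OF D(1)] b(3)[OF D(2)] by simp
    finally show ?thesis using ms es_nth[OF that] by auto
  qed
  then have "\<forall>i. \<exists>ms. i \<le> n \<longrightarrow> walk (hyperedge_graph A (es ! i)) (node (Z i)) ms (node (Z (Suc i))) \<and>
      displacement ms = Z (Suc i) - Z i" by blast
  then obtain seg where seg: "\<And>i. i \<le> n \<Longrightarrow>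
      walk (hyperedge_graph A (es ! i)) (node (Z i)) (seg i) (node (Z (Suc i))) \<and>
      displacement (seg i) = Z (Suc i) - Z i" by metis
  have handover: "node (Z (Suc i)) \<in> outgoing A (es ! i) \<inter> incoming A (es ! Suc i)" if "i < n" for i
  proof -
    have Zi: "Z (Suc i) = q i" using that unfolding Z_def by simp
    note qi = q[OF that]
    have "node (q i) \<in> outgoing A (hyp (f i))" using born_facts(6)[of "q i"] qi by auto
    moreover have "node (q i) \<in> incoming A (hyp (f (Suc i)))" using used_facts(3)[of "q i"] qi by blast
    ultimately show ?thesis using es_nth[of i] es_nth[of "Suc i"] that Zi by simp
  qed
  have "derivation_loop A es"
    unfolding derivation_loop_def
  proof (intro conjI allI impI)
    show "2 \<le> length es" using \<open>0 < n\<close> len by simp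
    show "set es \<subseteq> hyperedges A"
    proof
      fix e assume "e \<in> set es"
      then obtain i where "i \<le> n" "e = hyp (f i)" unfolding es_def by (auto simp del: upt_Suc simp: less_Suc_eq_le)
      then show "e \<in> hyperedges A" using inocc_facts(1)[OF Z_D conjunct1[OF Z_in]] by simp
    qed
    have "es \<noteq> []" using len by auto
    then have "hd es = es ! 0" "last es = es ! n" using len by (simp_all add: hd_conv_nth last_conv_nth)
    then show "hd es = last es" using es_nth f(1,2) by simp
    show "outgoing A (es ! i) \<inter> incoming A (es ! Suc i) \<noteq> {}" if "Suc i < length es" for i
      using handover[of i] that len by auto
  qed
  moreover have "balanced (concat (map seg [0..<length es]))"
  proof -
    \<comment> \<open>Differences of positions telescope, and the walk ends at its starting
      cell.\<close>
    have "(\<Sum>i<Suc n. displacement (seg i)) = (\<Sum>i<Suc n. Z (Suc i) - Z i)"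
      by (rule sum.cong) (use seg in auto)
    also have "\<dots> = Z (Suc n) - Z 0" by (rule sum_lessThan_telescope)
    also have "\<dots> = 0" unfolding Z_def by simp
    finally show ?thesis unfolding balanced_iff displacement_concat len .
  qed
  ultimately have "strong_loop A es"
    unfolding strong_loop_def
    by (intro conjI exI[of _ "\<lambda>i. node (Z i)"] exI[of _ seg])
      (use len handover seg in \<open>auto simp: Z_def less_Suc_eq_le\<close>)
  then show False using assms by blast
qed

text \<open>
  The initial configuration uses the nodes \<open>Inl x\<close>, so the cells of the root occurrence have to be
  named in this way.
\<close>

definition name :: "int \<times> int \<Rightarrow> 'n + nat" where
  "name q = (if fst (creator (\<sigma> q)) then Inl (node q)
     else Inr (prod_encode (nat (fst q), nat (snd q))))"

section \<open>Partially built pictures as configurations\<close>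

definition cells :: "'e occurrence set \<Rightarrow> (int \<times> int) set" where
  "cells T = {q \<in> D. born q \<in> T}"

definition node_of :: "'n + nat \<Rightarrow> 'n" where
  "node_of v = node (inv_into D name v)"

definition name_edges :: "bool \<Rightarrow> (int \<times> int) set \<Rightarrow> (('n + nat) \<times> ('n + nat)) set" where
  "name_edges d S = {(name a, name b) | a b. a \<in> S \<and> b \<in> S \<and> b = a + step d}"

definition cell_graph :: "(int \<times> int) set \<Rightarrow> ('n + nat, 's) pgraph" where
  "cell_graph S = \<lparr>nodes = name ` S, vedges = name_edges True S, hedges = name_edges False S,
     label = label (underlying A) \<circ> node_of\<rparr>"

text \<open>The active nodes after the occurrences of \<open>T\<close>: a cell whose consumer lies
  outside \<open>T\<close> is still waiting for it.\<close>

definition open_cells :: "'e occurrence set \<Rightarrow> (int \<times> int) set" where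
  "open_cells T = {q \<in> cells T. node q \<in> outgoing A (hyp (born q)) \<and> (\<forall>t \<in> T. used q \<noteq> Some t)}"

text \<open>\<open>g\<close> and the labels are prescribed on names of cells only, because the
  initial configuration has \<open>projl\<close> in place of \<open>node_of\<close>. Demanding all
  edges between adjacent cells makes the graph full.\<close>

definition stage :: "'e occurrence set \<Rightarrow> ('n, 's) configuration \<Rightarrow> bool" where
  "stage T = (\<lambda>(M, Act, g). connected_graph M \<and> nodes M = name ` cells T \<and>
     (\<forall>d. edges d M = name_edges d (cells T)) \<and> Act = name ` open_cells T \<and>
     (\<forall>q \<in> cells T. g (name q) = node q \<and> label M (name q) = label (underlying A) (node q)))"

text \<open>Root cells belong to a single occurrence, in which the node determines the position;
  other names encode the position itself.\<close>

lemma inj_name: "inj_on name D"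
proof (rule inj_onI)
  fix q q' assume q: "q \<in> D" and q': "q' \<in> D" and eq: "name q = name q'"
  show "q = q'"
  proof (cases "fst (creator (\<sigma> q))")
    case True
    then have r': "fst (creator (\<sigma> q'))" using eq unfolding name_def by (simp split: if_splits)
    have n: "node q = node q'" using eq True r' unfolding name_def by simp
    have "born q = born q'"
      by (rule root_unique) (use born_Occ q q' True r' in simp_all)
    moreover have "q = place (born q) (node q)" "q' = place (born q') (node q')"
      using inocc_facts(3) q q' by (simp_all add: inocc_def)
    ultimately show ?thesis using n by metis
  next
    case False
    then have "nat (fst q) = nat (fst q')" "nat (snd q) = nat (snd q')"
      using eq unfolding name_def by (auto split: if_splits)
    then show ?thesis using q q' unfolding rect_def by (auto simp: prod_eq_iff mem_Times_iff)
  qed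
qed

lemma node_of_name [simp]: "q \<in> D \<Longrightarrow> node_of (name q) = node q"
  unfolding node_of_def by (simp add: inv_into_f_f[OF inj_name])

lemma name_eq_iff: "a \<in> D \<Longrightarrow> b \<in> D \<Longrightarrow> name a = name b \<longleftrightarrow> a = b"
  using inj_name by (auto simp: inj_on_def)

lemma name_image_iff: "q \<in> D \<Longrightarrow> S \<subseteq> D \<Longrightarrow> name q \<in> name ` S \<longleftrightarrow> q \<in> S"
  using inj_name by (auto simp: inj_on_def)

lemma cells_D: "cells T \<subseteq> D"
  unfolding cells_def by blast

lemma open_cells_D: "open_cells T \<subseteq> D"
  unfolding open_cells_def cells_def by blast

lemma name_edges_iff:
  assumes "S \<subseteq> D" "a \<in> D" "b \<in> D"
  shows "(name a, name b) \<in> name_edges d S \<longleftrightarrow> a \<in> S \<and> b \<in> S \<and> b = a + step d"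
proof
  assume "(name a, name b) \<in> name_edges d S"
  then obtain a' b' where "name a = name a'" "name b = name b'" "a' \<in> S" "b' \<in> S" "b' = a' + step d"
    unfolding name_edges_def by blast
  moreover from this have "a = a'" "b = b'" using name_eq_iff assms by blast+
  ultimately show "a \<in> S \<and> b \<in> S \<and> b = a + step d" by simp
next
  assume "a \<in> S \<and> b \<in> S \<and> b = a + step d"
  then show "(name a, name b) \<in> name_edges d S" unfolding name_edges_def by blast
qed

lemma edges_cell_graph [simp]: "edges d (cell_graph S) = name_edges d S"
  by (cases d) (simp_all add: edges_def cell_graph_def)

lemma cell_graph_D:
  shows "pseudo_picture_graph (alphabet A) (cell_graph D)"
    and "grid_coordinates h w (cell_graph D) (\<lambda>v. map_prod nat nat (inv_into D name v))"
proof -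
  have lab: "label (underlying A) (node q) \<in> alphabet A" if "q \<in> D" for q
  proof -
    have "node q \<in> nodes (underlying A)"
      using born_facts(1,2)[OF that] automaton_hyperedge(1)[OF A] by blast
    then show ?thesis
      using A unfolding sa_hypergraph_automaton_def pseudo_picture_graph_def by blast
  qed
  have "name_edges True D \<inter> name_edges False D = {}"
  proof -
    have False if "a \<in> D" "b \<in> D" "a + step True \<in> D" "b + step False \<in> D"
      "name a = name b" "name (a + step True) = name (b + step False)" for a b
      using that by (simp add: name_eq_iff) (simp add: step_def)
    then show ?thesis unfolding name_edges_def by (auto, metis)
  qed
  moreover have "name_edges d D \<subseteq> name ` D \<times> name ` D" for d
    unfolding name_edges_def by blast
  ultimately show "pseudo_picture_graph (alphabet A) (cell_graph D)"
    using lab finite_D unfolding pseudo_picture_graph_def by (auto simp: cell_graph_def)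
  have inv: "inv_into D name (name q) = q" if "q \<in> D" for q
    using inv_into_f_f[OF inj_name that] .
  show "grid_coordinates h w (cell_graph D) (\<lambda>v. map_prod nat nat (inv_into D name v))"
    unfolding grid_coordinates_def
  proof (intro conjI ballI)
    show "bij_betw (\<lambda>v. map_prod nat nat (inv_into D name v)) (nodes (cell_graph D)) ({..<h} \<times> {..<w})"
    proof (rule bij_betw_byWitness[where f' = "\<lambda>(i, j). name (int i, int j)"])
      show "\<forall>v\<in>nodes (cell_graph D). (case map_prod nat nat (inv_into D name v) of (i, j) \<Rightarrow> name (int i, int j)) = v"
        using inv by (auto simp: cell_graph_def elim!: rect_cases)
      show "\<forall>ij\<in>{..<h} \<times> {..<w}. map_prod nat nat (inv_into D name (case ij of (i, j) \<Rightarrow> name (int i, int j))) = ij"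
        using inv by auto
      show "(\<lambda>v. map_prod nat nat (inv_into D name v)) ` nodes (cell_graph D) \<subseteq> {..<h} \<times> {..<w}"
        using inv by (auto simp: cell_graph_def rect_def)
      show "(\<lambda>(i, j). name (int i, int j)) ` ({..<h} \<times> {..<w}) \<subseteq> nodes (cell_graph D)"
        by (auto simp: cell_graph_def)
    qed
  next
    fix u v assume "u \<in> nodes (cell_graph D)" "v \<in> nodes (cell_graph D)"
    then obtain a b where ab: "a \<in> D" "b \<in> D" and u: "u = name a" and v: "v = name b"
      by (auto simp: cell_graph_def)
    have e: "(u, v) \<in> edges d (cell_graph D) \<longleftrightarrow> b = a + step d" for d
      using ab by (simp add: u v name_edges_iff)
    show "((u, v) \<in> vedges (cell_graph D)) = ((fst (map_prod nat nat (inv_into D name u)) + 1,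
        snd (map_prod nat nat (inv_into D name u))) = map_prod nat nat (inv_into D name v))"
      using e[of True] ab by (auto simp: u v inv edges_def step_def elim!: rect_cases)
    show "((u, v) \<in> hedges (cell_graph D)) = ((fst (map_prod nat nat (inv_into D name u)),
        snd (map_prod nat nat (inv_into D name u)) + 1) = map_prod nat nat (inv_into D name v))"
      using e[of False] ab by (auto simp: u v inv edges_def step_def elim!: rect_cases)
  qed
qed

text \<open>The subgrid condition holds because a stage keeps all adjacencies between its cells: it
  is a full subgraph of the picture graph \<open>cell_graph D\<close>.\<close>

lemma stage_configuration:
  assumes "stage T (M, Act, g)"
  shows "is_configuration A (M, Act, g)"
proof -
  let ?U = "underlying A"
  have M: "connected_graph M" "nodes M = name ` cells T" "\<And>d. edges d M = name_edges d (cells T)"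
    "Act = name ` open_cells T"
    "\<And>q. q \<in> cells T \<Longrightarrow> g (name q) = node q \<and> label M (name q) = label ?U (node q)"
    using assms unfolding stage_def by auto
  have sub: "nodes M \<subseteq> nodes (cell_graph D)" using M(2) cells_D by (auto simp: cell_graph_def)
  have restr: "edges d M = edges d (cell_graph D) \<inter> nodes M \<times> nodes M" for d
  proof -
    have "(name a, name b) \<in> name_edges d (cells T) \<longleftrightarrow>
        (name a, name b) \<in> name_edges d D \<and> name a \<in> name ` cells T \<and> name b \<in> name ` cells T"
      if "a \<in> D" "b \<in> D" for a b
      using that cells_D by (auto simp: name_edges_iff name_image_iff)
    moreover have "\<exists>a b. p = (name a, name b) \<and> a \<in> D \<and> b \<in> D"
      if "p \<in> name_edges d S" "S \<subseteq> D" for p S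
      using that unfolding name_edges_def by blast
    ultimately have "p \<in> name_edges d (cells T) \<longleftrightarrow>
        p \<in> name_edges d D \<inter> name ` cells T \<times> name ` cells T" for p
      using cells_D[of T] by (metis (no_types, lifting) IntE IntI SigmaD1 SigmaD2 SigmaI order_refl)
    then show ?thesis unfolding M(2,3) edges_cell_graph by blast
  qed
  have lab: "label M v = label (cell_graph D) v" if "v \<in> nodes M" for v
    using that M(2,5) cells_D by (auto simp: cell_graph_def subset_iff)
  have full: "full_subgraph M (cell_graph D)"
    using sub restr[of True] restr[of False] lab unfolding full_subgraph_def edges_def by simp
  have "pseudo_picture_graph (alphabet A) M"
  proof -
    have "label M ` nodes M = label (cell_graph D) ` nodes M" using lab by (rule image_cong[OF refl])
    also have "\<dots> \<subseteq> label (cell_graph D) ` nodes (cell_graph D)" using sub by (rule image_mono)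
    also have "\<dots> \<subseteq> alphabet A" using cell_graph_D(1) unfolding pseudo_picture_graph_def by blast
    finally show ?thesis
      using cell_graph_D(1) full finite_subset[OF sub]
      unfolding pseudo_picture_graph_def full_subgraph_def by blast
  qed
  moreover have "picture_graph (alphabet A) (cell_graph D)"
    using cell_graph_D pos_h pos_w unfolding picture_graph_def by blast
  ultimately have "subgrid (alphabet A) M"
    using M(1) full unfolding subgrid_def by blast
  moreover have "node q \<in> nodes ?U" if "q \<in> cells T" for q
    using born_facts(1,2) automaton_hyperedge(1)[OF A] that cells_D by blast
  ultimately show ?thesis
    unfolding is_configuration_def using M by (auto simp: open_cells_def)
qed

text \<open>A root occurrence creates all of its nodes, so its cells are a full copy of the
  hyperedge graph, and their names \<open>Inl y\<close> make the two graphs literally agree.\<close>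

lemma stage_initial:
  assumes t: "t \<in> Occ" "fst (fst t)"
  shows "hyp t \<in> initial_hyperedges A \<and> stage {t} (initial_configuration A (hyp t))"
proof
  let ?e = "hyp t"
  note p = place_in[OF t(1)]
  have bornp: "born (place t y) = t" if "y \<in> incidence A ?e" for y
    using born_used_iff(1)[OF p(1,3)] that t(2) by blast
  obtain y0 where y0: "y0 \<in> incidence A ?e" using Occ_facts(3)[OF t(1)] by blast
  show init: "?e \<in> initial_hyperedges A"
    using born_facts(3)[OF p(1)[OF y0]] bornp[OF y0] t(2) by simp
  have cells: "cells {t} = place t ` incidence A ?e"
  proof (intro equalityI subsetI)
    fix q assume "q \<in> cells {t}"
    then have "q \<in> D" "inocc q t" unfolding cells_def inocc_def by auto
    then show "q \<in> place t ` incidence A ?e" using inocc_facts(2,3) by blast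
  qed (use p bornp in \<open>auto simp: cells_def\<close>)
  have name: "name (place t y) = Inl y" if "y \<in> incidence A ?e" for y
  proof -
    have "creator (\<sigma> (place t y)) = fst t" using fst_born bornp[OF that] by metis
    then show ?thesis using t(2) p(2)[OF that] unfolding name_def by simp
  qed
  note sub = automaton_hyperedge[OF A Occ_facts(1)[OF t(1)]]
  have opened: "open_cells {t} = place t ` outgoing A ?e"
  proof (intro equalityI subsetI)
    fix q assume q: "q \<in> open_cells {t}"
    then obtain y where y: "y \<in> incidence A ?e" "q = place t y"
      using cells unfolding open_cells_def by blast
    then show "q \<in> place t ` outgoing A ?e"
      using q p(2) bornp unfolding open_cells_def by (auto simp del: fst_born)
  next
    fix q assume "q \<in> place t ` outgoing A ?e"
    then obtain y where y: "y \<in> outgoing A ?e" "q = place t y" by blast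
    then have yi: "y \<in> incidence A ?e" using sub by blast
    \<comment> \<open>Root occurrences never consume, so all outgoing cells are open at the
      start.\<close>
    have "used q \<noteq> Some t" using used_facts(2) t(2) p(1)[OF yi] y(2) by blast
    then show "q \<in> open_cells {t}"
      using y yi p(2) bornp cells unfolding open_cells_def by (auto simp del: fst_born)
  qed
  define M :: "('n + nat, 's) pgraph" where "M = rename_graph Inl projl (hyperedge_graph A ?e)"
  have nM: "nodes M = Inl ` incidence A ?e"
    by (simp add: M_def rename_graph_def)
  have eM: "edges d M = map_prod Inl Inl ` (edges d (underlying A) \<inter> incidence A ?e \<times> incidence A ?e)" for d
    by (auto simp: M_def rename_graph_def edges_def hyperedge_graph_def induced_graph_def)
  have conn: "connected_graph M"
  proof (rule connected_graph_image)
    show "connected_graph (hyperedge_graph A ?e)"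
      using A Occ_facts(1)[OF t(1)] unfolding sa_hypergraph_automaton_def by blast
    show "nodes M = Inl ` nodes (hyperedge_graph A ?e)" using nM by simp
    show "(Inl u, Inl v) \<in> edges d M" if "(u, v) \<in> edges d (hyperedge_graph A ?e)" for u v d
      using that unfolding eM edges_hyperedge_graph by (auto intro: image_eqI[of _ _ "(u, v)"])
  qed
  have "edges d M = name_edges d (cells {t})" for d
  proof -
    have "edges d M = {(Inl y, Inl z) | y z. y \<in> incidence A ?e \<and> z \<in> incidence A ?e \<and> place t z = place t y + step d}"
      unfolding eM using place_edge[OF t(1)] by auto
    also have "\<dots> = {(name (place t y), name (place t z)) | y z.
        y \<in> incidence A ?e \<and> z \<in> incidence A ?e \<and> place t z = place t y + step d}"
      using name by (metis (no_types, lifting))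
    also have "\<dots> = name_edges d (cells {t})"
      unfolding name_edges_def cells by blast
    finally show ?thesis .
  qed
  moreover have "nodes M = name ` cells {t}" "Inl ` outgoing A ?e = name ` open_cells {t}"
    unfolding nM cells opened image_image using name sub by (auto simp: image_iff subset_iff)
  moreover have "projl (name q) = node q \<and> label M (name q) = label (underlying A) (node q)"
    if "q \<in> cells {t}" for q
    using that name p(2) unfolding cells
    by (auto simp: M_def rename_graph_def hyperedge_graph_def induced_graph_def)
  ultimately have "stage {t} (M, Inl ` outgoing A ?e, projl)"
    using conn unfolding stage_def by simp
  then show "stage {t} (initial_configuration A ?e)"
    unfolding initial_configuration_def M_def .
qed

text \<open>All predecessors of \<open>t\<close> are in \<open>T\<close>, so its incoming cells
  exist and are still open. Since \<open>T\<close> is closed under predecessors, no occurrence of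
  \<open>T\<close> has consumed a cell that \<open>t\<close> creates.\<close>

lemma stage_step:
  assumes acyclic: "acyclic pred"
    and st: "stage T (M, Act, g)" and closed: "\<And>s t. (s, t) \<in> pred \<Longrightarrow> t \<in> T \<Longrightarrow> s \<in> T"
    and t: "t \<in> Occ" "t \<notin> T" "\<not> fst (fst t)" and preds: "\<And>s. (s, t) \<in> pred \<Longrightarrow> s \<in> T"
  shows "\<exists>C. transition A (M, Act, g) C \<and> stage (insert t T) C"
proof -
  let ?U = "underlying A" and ?e = "hyp t" and ?T = "insert t T"
  define I where "I = incidence A ?e"
  define Q where "Q = incoming A ?e"
  note eE = Occ_facts(1)[OF t(1)]
  note sub = automaton_hyperedge[OF A eE, folded I_def Q_def]
  note p = place_in[OF t(1), folded I_def]
  have M: "connected_graph M" "nodes M = name ` cells T" "\<And>d. edges d M = name_edges d (cells T)"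
    "Act = name ` open_cells T"
    "\<And>q. q \<in> cells T \<Longrightarrow> g (name q) = node q \<and> label M (name q) = label ?U (node q)"
    using st unfolding stage_def by auto
  have usedp: "used (place t y) = Some t" if "y \<in> Q" for y
    using born_used_iff(2)[OF p(1,3), of y] p(2)[of y] that t(3) sub unfolding Q_def by auto
  have bornp: "born (place t y) = t" if "y \<in> I" "y \<notin> Q" for y
    using born_used_iff(1)[OF p(1,3), of y] p(2)[of y] that t(3) unfolding Q_def by auto
  have old: "place t y \<in> cells T" if "y \<in> Q" for y
  proof -
    have "place t y \<in> D" using p(1) that sub by blast
    then have "(born (place t y), t) \<in> pred" using usedp[OF that] unfolding pred_def by blast
    then show ?thesis using preds \<open>place t y \<in> D\<close> unfolding cells_def by blast
  qed
  have new: "place t y \<notin> cells T" if "y \<in> I" "y \<notin> Q" for y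
    using bornp[OF that] t(2) unfolding cells_def by auto
  have inocc_place: "\<exists>y \<in> I. q = place t y \<and> node q = y" if "q \<in> D" "inocc q t" for q
    using inocc_facts(2,3)[OF that] unfolding I_def by blast
  have cells': "cells ?T = cells T \<union> place t ` (I - Q)"
  proof (intro equalityI subsetI)
    fix q assume q: "q \<in> cells ?T"
    show "q \<in> cells T \<union> place t ` (I - Q)"
    proof (cases "born q = t")
      case True
      then obtain y where y: "y \<in> I" "q = place t y"
        using inocc_place[of q] q unfolding cells_def inocc_def by blast
      then show ?thesis using old by blast
    qed (use q in \<open>auto simp: cells_def\<close>)
  next
    fix q assume "q \<in> cells T \<union> place t ` (I - Q)"
    then show "q \<in> cells ?T" using p(1) bornp unfolding cells_def by auto
  qed
  have all: "place t y \<in> cells ?T" if "y \<in> I" for y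
    using that old unfolding cells' by blast
  define k where "k y = name (place t y)" for y
  have k_edge: "(k y, k z) \<in> name_edges d S \<longleftrightarrow> (y, z) \<in> edges d ?U"
    if "y \<in> I" "z \<in> I" "place t y \<in> S" "place t z \<in> S" "S \<subseteq> D" for y z d S
    using that p(1) name_edges_iff[of S "place t y" "place t z" d] place_edge[OF t(1), folded I_def, of y z d]
    unfolding k_def by simp
  define P where "P = k ` Q"
  define New where "New = I - Q"
  define M2 where "M2 = cell_graph (cells ?T)"
  define Act2 where "Act2 = name ` open_cells ?T"
  have PI: "P \<union> k ` New = k ` I" unfolding P_def New_def using sub by blast
  have g_old: "node_of v = g v" if "v \<in> nodes M" for v
    using that M(2,5) cells_D by (auto simp: subset_iff)
  have node_k: "node_of (k y) = y" if "y \<in> I" for y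
    using p that unfolding k_def by simp
  have g_k: "g (k y) = y" if "y \<in> Q" for y
    using M(5)[OF old[OF that]] p(2) that sub unfolding k_def by auto
  have e2: "edges d M2 = edges d M \<union>
      {(u, v). u \<in> P \<union> k ` New \<and> v \<in> P \<union> k ` New \<and> (node_of u, node_of v) \<in> edges d ?U}" for d
  proof (intro equalityI subsetI)
    fix uv assume "uv \<in> edges d M2"
    then obtain a b where uv: "uv = (name a, name b)" and a: "a \<in> cells ?T" and b: "b \<in> cells ?T"
      and ab: "b = a + step d" unfolding M2_def edges_cell_graph name_edges_def by blast
    have aD: "a \<in> D" and bD: "b \<in> D" using a b cells_D by blast+
    show "uv \<in> edges d M \<union>
      {(u, v). u \<in> P \<union> k ` New \<and> v \<in> P \<union> k ` New \<and> (node_of u, node_of v) \<in> edges d ?U}"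
    proof (cases "a \<in> cells T \<and> b \<in> cells T")
      case True
      then show ?thesis using ab uv unfolding M(3) name_edges_def by blast
    next
      case False
      \<comment> \<open>The only bad case is an old \<open>u\<close> whose creator contains the new
        cell \<open>v\<close>: then that creator consumes \<open>v\<close>, so \<open>t\<close>
        precedes a member of \<open>T\<close> and would lie in \<open>T\<close> itself.\<close>
      have shared: "inocc u t \<and> inocc v t"
        if uv': "u \<in> D" "v \<in> D" "u \<in> cells ?T" "v \<in> cells ?T" "\<not> (u \<in> cells T \<and> v \<in> cells T)"
          "inocc v (born u)" for u v
      proof (cases "born u = t")
        case True
        then show ?thesis using uv'(6) by (simp add: inocc_def)
      next
        case False
        then have uT: "born u \<in> T" using uv'(3) unfolding cells_def by blast
        then have bv: "born v = t" using uv' unfolding cells_def by blast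
        then have "used v = Some (born u)" using uv'(6) False unfolding inocc_def by simp
        then have "(t, born u) \<in> pred" using bv uv'(2) unfolding pred_def by blast
        then show ?thesis using closed uT t(2) by blast
      qed
      have "inocc a t \<and> inocc b t"
        using adjacent_inocc(2)[OF aD bD ab] shared[OF aD bD a b False] shared[OF bD aD b a] False by blast
      then have "name a \<in> k ` I" "name b \<in> k ` I"
        using inocc_place aD bD unfolding k_def by blast+
      then show ?thesis using adjacent_inocc(1)[OF aD bD ab] aD bD unfolding PI uv by simp
    qed
  next
    fix uv assume "uv \<in> edges d M \<union>
      {(u, v). u \<in> P \<union> k ` New \<and> v \<in> P \<union> k ` New \<and> (node_of u, node_of v) \<in> edges d ?U}"
    then consider "uv \<in> edges d M" | y z where "y \<in> I" "z \<in> I" "uv = (k y, k z)" "(y, z) \<in> edges d ?U"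
      unfolding PI using node_k by auto
    then show "uv \<in> edges d M2"
    proof cases
      case 1
      then show ?thesis unfolding M(3) M2_def edges_cell_graph name_edges_def cells' by blast
    next
      case 2
      then show ?thesis unfolding M2_def edges_cell_graph using k_edge all cells_D by simp
    qed
  qed
  have nM2: "nodes M2 = nodes M \<union> k ` New"
    unfolding M2_def M(2) New_def k_def by (auto simp: cell_graph_def cells')
  have kM: "k ` New \<inter> nodes M = {}"
  proof -
    have "k y \<notin> nodes M" if "y \<in> New" for y
      using that new[of y] p(1)[of y] cells_D name_image_iff[of "place t y" "cells T"]
      unfolding M(2) k_def New_def by blast
    then show ?thesis by blast
  qed
  \<comment> \<open>Without incoming nodes every cell of \<open>t\<close> would be created by it,
    which \<open>valid_cell\<close> excludes for an ordinary copy.\<close>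
  have Q_ne: "Q \<noteq> {}"
  proof
    assume "Q = {}"
    obtain q where q: "q \<in> D" "inocc q t" using t(1) unfolding Occ_def by blast
    then have "born q = t" using born_used_iff(1) \<open>Q = {}\<close> unfolding Q_def by blast
    then show False using born_facts(4)[OF q(1)] t(3) \<open>Q = {}\<close> unfolding Q_def by blast
  qed
  have conn: "connected_graph M2"
  proof (rule connected_graph_glue[OF M(1)])
    show "connected_graph (hyperedge_graph A ?e)"
      using A eE unfolding sa_hypergraph_automaton_def by blast
    show "nodes M2 = nodes M \<union> k ` nodes (hyperedge_graph A ?e)"
      unfolding nM2 New_def using old sub unfolding M(2) k_def nodes_hyperedge_graph I_def by blast
    show "edges d M \<subseteq> edges d M2" for d unfolding e2 by blast
    show "(k u, k v) \<in> edges d M2" if "(u, v) \<in> edges d (hyperedge_graph A ?e)" for u v d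
      using that node_k unfolding e2 PI edges_hyperedge_graph I_def by auto
    show "(SOME y. y \<in> Q) \<in> nodes (hyperedge_graph A ?e)" "k (SOME y. y \<in> Q) \<in> nodes M"
      using Q_ne sub old unfolding M(2) k_def nodes_hyperedge_graph I_def
      by (metis some_in_eq subsetD, metis some_in_eq imageI)
  qed
  \<comment> \<open>Having a consumer, these cells are outgoing for their creators; the consumer is
    \<open>t\<close>, which is not in \<open>T\<close>, so they are active.\<close>
  have P_Act: "P \<subseteq> Act"
  proof -
    have "place t y \<in> open_cells T" if y: "y \<in> Q" for y
    proof -
      have D: "place t y \<in> D" using old[OF y] cells_D by blast
      have "node (place t y) \<in> outgoing A (hyp (born (place t y)))"
        using born_facts(6)[OF D] usedp[OF y] by simp
      then show ?thesis using old[OF y] usedp[OF y] t(2) unfolding open_cells_def by auto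
    qed
    then show ?thesis unfolding P_def M(4) k_def by blast
  qed
  have Act2_eq: "Act2 = (Act - P) \<union> k ` (New \<inter> outgoing A ?e)"
  proof -
    have "q \<in> open_cells ?T \<longleftrightarrow> q \<in> open_cells T - place t ` Q \<or> q \<in> place t ` (New \<inter> outgoing A ?e)"
      (is "?l \<longleftrightarrow> ?r") for q
    proof
      assume l: ?l
      show ?r
      proof (cases "q \<in> cells T")
        case True
        then have "q \<in> open_cells T" using l unfolding open_cells_def by blast
        moreover have "q \<notin> place t ` Q" using l usedp unfolding open_cells_def by auto
        ultimately show ?thesis by blast
      next
        case False
        then obtain y where y: "y \<in> I - Q" "q = place t y"
          using l unfolding open_cells_def cells' by blast
        then have "y \<in> outgoing A ?e"
          using l bornp p(2) unfolding open_cells_def by (auto simp del: fst_born)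
        then show ?thesis using y unfolding New_def by blast
      qed
    next
      assume ?r
      then show ?l
      proof
        assume a: "q \<in> open_cells T - place t ` Q"
        then have qD: "q \<in> D" using open_cells_D by blast
        have "used q \<noteq> Some t"
        proof
          assume "used q = Some t"
          then have "inocc q t" "node q \<in> Q"
            using used_facts(3)[OF qD] unfolding inocc_def Q_def by blast+
          then have "q \<in> place t ` Q" using inocc_facts(3)[OF qD] by (intro image_eqI)
          then show False using a by blast
        qed
        then show ?l using a unfolding open_cells_def cells' by blast
      next
        assume "q \<in> place t ` (New \<inter> outgoing A ?e)"
        then obtain y where y: "y \<in> I" "y \<notin> Q" "y \<in> outgoing A ?e" "q = place t y"
          unfolding New_def by blast
        have qD: "q \<in> D" and b: "born q = t" using y p(1) bornp by blast+
        have "used q \<noteq> Some s" if "s \<in> ?T" for s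
        \<comment> \<open>Consumption by \<open>t\<close> would be a cycle of length one, and
          consumption by a member of \<open>T\<close> would put \<open>t\<close> into
          \<open>T\<close>.\<close>
        proof
          assume "used q = Some s"
          then have ts: "(t, s) \<in> pred" using b qD unfolding pred_def by blast
          then have "s \<noteq> t" using acyclic unfolding acyclic_def by blast
          then show False using closed[OF ts] that t(2) by blast
        qed
        then show ?l using all[OF y(1)] y p(2) b unfolding open_cells_def by (auto simp del: fst_born)
      qed
    qed
    then have "open_cells ?T = (open_cells T - place t ` Q) \<union> place t ` (New \<inter> outgoing A ?e)" by blast
    then have "Act2 = name ` (open_cells T - place t ` Q) \<union> k ` (New \<inter> outgoing A ?e)"
      unfolding Act2_def k_def by (auto simp: image_Un image_image)
    also have "name ` (open_cells T - place t ` Q) = Act - P"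
    proof -
      have "place t ` Q \<subseteq> D" using p(1) sub by blast
      moreover have "open_cells T - place t ` Q \<subseteq> D" using open_cells_D by blast
      ultimately have "name ` (open_cells T - place t ` Q) = name ` open_cells T - name ` place t ` Q"
        by (intro inj_on_image_set_diff[OF inj_name])
      then show ?thesis unfolding M(4) P_def k_def image_image .
    qed
    finally show ?thesis .
  qed
  have stage2: "stage ?T (M2, Act2, node_of)"
    unfolding stage_def prod.case using conn cells_D
    by (auto simp: M2_def Act2_def cell_graph_def subset_iff edges_cell_graph[unfolded cell_graph_def])
  have iso: "graph_isomorphism g (induced_graph M P) (induced_graph (hyperedge_graph A ?e) Q)"
  proof -
    have "bij_betw g P Q"
      by (rule bij_betw_byWitness[where f' = k]) (use g_k in \<open>auto simp: P_def\<close>)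
    moreover have "(u, v) \<in> edges d (induced_graph M P) \<longleftrightarrow>
        (g u, g v) \<in> edges d (induced_graph (hyperedge_graph A ?e) Q)" if uv: "u \<in> P" "v \<in> P" for u v d
    proof -
      obtain y z where y: "y \<in> Q" "u = k y" and z: "z \<in> Q" "v = k z" using uv unfolding P_def by blast
      have "(k y, k z) \<in> edges d M \<longleftrightarrow> (y, z) \<in> edges d ?U"
        unfolding M(3) using y z sub old cells_D by (intro k_edge) auto
      then show ?thesis
        using y z uv g_k sub by (auto simp: edges_induced edges_hyperedge_graph I_def[symmetric])
    qed
    from this[of _ _ True] this[of _ _ False]
    have "\<forall>u \<in> P. \<forall>v \<in> P. ((u, v) \<in> vedges (induced_graph M P) \<longleftrightarrow>
        (g u, g v) \<in> vedges (induced_graph (hyperedge_graph A ?e) Q)) \<and>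
      ((u, v) \<in> hedges (induced_graph M P) \<longleftrightarrow>
        (g u, g v) \<in> hedges (induced_graph (hyperedge_graph A ?e) Q))"
      by (simp add: edges_def)
    moreover have "label M u = label ?U (g u)" if uP: "u \<in> P" for u
    proof -
      obtain y where y: "y \<in> Q" "u = name (place t y)" using uP unfolding P_def k_def by blast
      show ?thesis using M(5)[OF old[OF y(1)]] unfolding y(2) by simp
    qed
    ultimately show ?thesis
      unfolding graph_isomorphism_def by (simp add: induced_graph_def hyperedge_graph_def)
  qed
  have "transition_by A ?e (M, Act, g) (M2, Act2, node_of)"
    unfolding transition_by_def prod.case Let_def I_def[symmetric] Q_def[symmetric] New_def[symmetric]
  proof (intro conjI exI[of _ P] exI[of _ k])
    show "is_configuration A (M, Act, g)" "is_configuration A (M2, Act2, node_of)"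
      using stage_configuration st stage2 by blast+
    show "P \<noteq> {}" unfolding P_def using Q_ne by blast
    show "inj_on k New" using node_k unfolding New_def by (metis DiffD1 inj_onI)
    show "\<forall>x\<in>nodes M. node_of x = g x" using g_old by blast
    show "\<forall>x\<in>New. node_of (k x) = x" using node_k unfolding New_def by blast
    show "vedges M2 = vedges M \<union> {(x, y). x \<in> P \<union> k ` New \<and> y \<in> P \<union> k ` New \<and> (node_of x, node_of y) \<in> vedges ?U}"
      using e2[of True] by (simp add: edges_def)
    show "hedges M2 = hedges M \<union> {(x, y). x \<in> P \<union> k ` New \<and> y \<in> P \<union> k ` New \<and> (node_of x, node_of y) \<in> hedges ?U}"
      using e2[of False] by (simp add: edges_def)
    show "\<forall>x\<in>nodes M2. label M2 x = label ?U (node_of x)"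
      by (simp add: M2_def cell_graph_def)
  qed (fact P_Act iso kM nM2 Act2_eq)+
  then show ?thesis using stage2 eE unfolding transition_def by blast
qed

text \<open>A finite acyclic relation is well-founded. Applying a minimal remaining occurrence each
  time keeps the applied set closed under predecessors, which is what a single step
  requires.\<close>

lemma run_exists:
  assumes acyclic: "acyclic pred"
  shows "\<exists>e \<in> initial_hyperedges A. \<exists>C. (transition A)\<^sup>*\<^sup>* (initial_configuration A e) C \<and> stage Occ C"
proof -
  have "pred \<subseteq> Occ \<times> Occ" unfolding pred_def using born_Occ used_Occ by blast
  then have "finite pred" using finite_Occ finite_subset by blast
  then have wf: "wf pred" using acyclic by (rule finite_acyclic_wf)
  have minimal: "\<exists>t \<in> S. \<forall>s. (s, t) \<in> pred \<longrightarrow> s \<notin> S" if "S \<noteq> {}" for S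
    using wf that unfolding wf_eq_minimal by blast
  have "(0, 0) \<in> D" using pos_h pos_w unfolding rect_def by simp
  then have "Occ \<noteq> {}" using born_Occ by blast
  then obtain r where r: "r \<in> Occ" "\<And>s. (s, r) \<in> pred \<Longrightarrow> s \<notin> Occ" using minimal by blast
  have no_pred: "(s, r) \<notin> pred" for s
    using r(2) \<open>pred \<subseteq> Occ \<times> Occ\<close> by blast
  \<comment> \<open>An ordinary occurrence has an incoming node, and the creator of the
    corresponding cell precedes it; a minimal one is therefore a root.\<close>
  have root: "fst (fst r)"
  proof (rule ccontr)
    assume nr: "\<not> fst (fst r)"
    obtain q where q: "q \<in> D" "inocc q r" using r(1) unfolding Occ_def by blast
    have "used q \<noteq> Some r" using no_pred q(1) unfolding pred_def by blast
    then have b: "born q = r" using q(2) unfolding inocc_def by blast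
    then obtain y where y: "y \<in> incoming A (hyp r)" using born_facts(4)[OF q(1)] nr by blast
    then have "y \<in> incidence A (hyp r)" using automaton_hyperedge(2)[OF A Occ_facts(1)[OF r(1)]] by blast
    note p = place_in[OF r(1) this]
    have "used (place r y) = Some r" using born_used_iff(2)[OF p(1,3)] nr p(2) y by simp
    then show False using no_pred p(1) unfolding pred_def by blast
  qed
  note init = stage_initial[OF r(1) root]
  have "\<exists>C. (transition A)\<^sup>*\<^sup>* (initial_configuration A (hyp r)) C \<and> stage Occ C"
    if "(transition A)\<^sup>*\<^sup>* (initial_configuration A (hyp r)) C" "stage T C" "r \<in> T" "T \<subseteq> Occ"
      "\<And>s t. (s, t) \<in> pred \<Longrightarrow> t \<in> T \<Longrightarrow> s \<in> T" for C T
    using that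
  proof (induction "card (Occ - T)" arbitrary: C T rule: less_induct)
    case less
    show ?case
    proof (cases "T = Occ")
      case True
      then show ?thesis using less.prems by blast
    next
      case False
      then have "Occ - T \<noteq> {}" using less.prems(4) by blast
      then obtain t where t: "t \<in> Occ" "t \<notin> T" "\<And>s. (s, t) \<in> pred \<Longrightarrow> s \<notin> Occ - T"
        using minimal[of "Occ - T"] by blast
      have preds: "s \<in> T" if "(s, t) \<in> pred" for s
        using t(3)[OF that] that \<open>pred \<subseteq> Occ \<times> Occ\<close> by blast
      \<comment> \<open>A second root cannot be pending: the only one is \<open>r\<close>, which has
        been in the set from the beginning.\<close>
      have nr: "\<not> fst (fst t)"
        using root_unique[OF t(1) r(1)] root t(2) less.prems(3) by blast
      obtain M Act g where C: "C = (M, Act, g)" by (cases C)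
      obtain C' where C': "transition A C C'" "stage (insert t T) C'"
      proof -
        have "\<exists>C'. transition A (M, Act, g) C' \<and> stage (insert t T) C'"
          by (rule stage_step[OF acyclic _ _ t(1,2) nr])
            (use less.prems(2,5) preds in \<open>auto simp: C\<close>)
        then show ?thesis using that unfolding C by blast
      qed
      show ?thesis
      proof (rule less.hyps)
        show "card (Occ - insert t T) < card (Occ - T)"
          using t finite_Occ by (intro psubset_card_mono) auto
        show "(transition A)\<^sup>*\<^sup>* (initial_configuration A (hyp r)) C'"
          using less.prems(1) C'(1) by simp
        show "s \<in> insert t T" if "(s, t') \<in> pred" "t' \<in> insert t T" for s t'
          using that preds less.prems(5) by blast
      qed (use C' less.prems t in auto)
    qed
  qed
  from this[of "initial_configuration A (hyp r)" "{r}"] show ?thesis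
    using init r(1) no_pred by blast
qed

lemma accepted:
  assumes acyclic: "acyclic pred"
    and p: "dim_row p = h" "dim_col p = w"
      "\<And>i j. i < h \<Longrightarrow> j < w \<Longrightarrow> label (underlying A) (node (int i, int j)) = p $$ (i, j)"
  shows "p \<in> picture_language A"
proof -
  obtain e M Act g where e: "e \<in> initial_hyperedges A"
    and run: "(transition A)\<^sup>*\<^sup>* (initial_configuration A e) (M, Act, g)" and st: "stage Occ (M, Act, g)"
    using run_exists[OF acyclic] by (metis prod_cases3)
  have cells: "cells Occ = D" using born_Occ unfolding cells_def by blast
  have M: "nodes M = name ` D" "\<And>d. edges d M = name_edges d D" "Act = name ` open_cells Occ"
    "\<And>q. q \<in> D \<Longrightarrow> g (name q) = node q \<and> label M (name q) = label (underlying A) (node q)"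
    using st unfolding stage_def cells by auto
  \<comment> \<open>By \<open>valid_cell\<close> an outgoing cell has a consumer, and now every
    occurrence has been applied.\<close>
  have "open_cells Occ = {}"
  proof -
    have False if q: "q \<in> open_cells Occ" for q
    proof -
      have qD: "q \<in> D" using q open_cells_D by blast
      then obtain t where "used q = Some t" using q born_facts(6)[OF qD] unfolding open_cells_def by auto
      then show False using q used_Occ[OF qD] unfolding open_cells_def by blast
    qed
    then show ?thesis by blast
  qed
  then have Act: "Act = {}" using M(3) by simp
  let ?f = "\<lambda>v. map_prod nat nat (inv_into D name v)"
  have same: "nodes M = nodes (cell_graph D)" "vedges M = vedges (cell_graph D)"
    "hedges M = hedges (cell_graph D)"
    using M(1) M(2)[of True] M(2)[of False] by (simp_all add: cell_graph_def edges_def)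
  have f: "grid_coordinates h w M ?f"
    using cell_graph_D(2) unfolding grid_coordinates_def same .
  have "label M ` nodes M \<subseteq> alphabet A"
  proof -
    have "label M v = label (cell_graph D) v" if "v \<in> nodes M" for v
      using that M(1,4) by (auto simp: cell_graph_def)
    then have "label M ` nodes M = label (cell_graph D) ` nodes (cell_graph D)"
      using same(1) by (metis image_cong)
    then show ?thesis using cell_graph_D(1) unfolding pseudo_picture_graph_def by simp
  qed
  then have pic: "picture_graph (alphabet A) M"
    using cell_graph_D(1) f pos_h pos_w
    unfolding picture_graph_def pseudo_picture_graph_def same by blast
  have "p = mat h w (\<lambda>ij. label M (inv_into (nodes M) ?f ij))"
  proof (rule eq_matI)
    fix i j assume "i < dim_row (mat h w (\<lambda>ij. label M (inv_into (nodes M) ?f ij)))"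
      "j < dim_col (mat h w (\<lambda>ij. label M (inv_into (nodes M) ?f ij)))"
    then have ij: "i < h" "j < w" by simp_all
    have q: "(int i, int j) \<in> D" using ij by simp
    have "?f (name (int i, int j)) = (i, j)" using inv_into_f_f[OF inj_name q] by simp
    moreover have "inj_on ?f (nodes M)" using f unfolding grid_coordinates_def bij_betw_def by blast
    ultimately have "inv_into (nodes M) ?f (i, j) = name (int i, int j)"
      using inv_into_f_f[of ?f "nodes M" "name (int i, int j)"] M(1) q by simp
    then show "p $$ (i, j) = mat h w (\<lambda>ij. label M (inv_into (nodes M) ?f ij)) $$ (i, j)"
      using ij M(4)[OF q] p(3)[OF ij] by simp
  qed (use p in simp_all)
  then have "represents_picture M p"
    using f pos_h pos_w unfolding represents_picture_def by blast
  moreover have "M \<in> accepted_graphs A"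
    using pic e run unfolding accepted_graphs_def Act by blast
  ultimately show ?thesis unfolding picture_language_def by blast
qed

end

theorem theorem2:
  fixes A :: "('n, 'e, 's) sa_automaton"
  assumes "sa_hypergraph_automaton A"
    and "\<not> (\<exists>es. strong_loop A es)"
  shows "wts_recognizable (alphabet A) (picture_language A)"
proof -
  have "picture_language A = {p \<in> pictures (alphabet A).
    \<exists>\<sigma>. tiling A (dim_row p) (dim_col p) \<sigma> \<and> (\<forall>i<dim_row p. \<forall>j<dim_col p.
      label (underlying A) (cell_node (\<sigma> (int i, int j))) = p $$ (i, j))}"
  proof (intro equalityI subsetI)
    fix p assume "p \<in> {p \<in> pictures (alphabet A).
      \<exists>\<sigma>. tiling A (dim_row p) (dim_col p) \<sigma> \<and> (\<forall>i<dim_row p. \<forall>j<dim_col p.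
        label (underlying A) (cell_node (\<sigma> (int i, int j))) = p $$ (i, j))}"
    then obtain \<sigma> where p: "p \<in> pictures (alphabet A)" and \<sigma>: "tiling A (dim_row p) (dim_col p) \<sigma>"
      and lab: "\<And>i j. i < dim_row p \<Longrightarrow> j < dim_col p \<Longrightarrow>
        label (underlying A) (cell_node (\<sigma> (int i, int j))) = p $$ (i, j)"
      by blast
    \<comment> \<open>Pictures have at least one row and one column, which provides the initial
      minimal occurrence.\<close>
    interpret tiled_picture A "dim_row p" "dim_col p" \<sigma>
      using assms(1) p \<sigma> by unfold_locales (auto simp: pictures_def)
    show "p \<in> picture_language A"
      using accepted[OF acyclic_pred[OF assms(2)]] lab by blast
  qed (use picture_language_tiling[OF assms(1)] in blast)
  then show ?thesis using wts_recognizable_tiling[OF assms(1)] by simp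
qed

end
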